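(* Let $V$ be a simple real Jordan algebra of dimension $n$ and rank $r$, let $\lambda,\mu\in\mathbb C$ and let $k\ge1$ be an integer. The symbol $b^{(k)}_{\lambda,\mu}$ of the bi-differential operator $B^{(k)}_{\lambda,\mu}=\operatorname{res}\circ F_{\lambda+k-1,\mu+k-1}\circ\cdots\circ F_{\lambda,\mu}$ is given by $$ b_{\lambda,\mu}^{(k)}(\xi, \zeta) = c_{\lambda-\frac{n}{r},\, \mu-\frac{n}{r}}^{(k)}(\xi, \zeta), $$ where, for $\lambda',\mu'\in\mathbb C$, $c^{(k)}_{\lambda',\mu'}$ is the polynomial on $V\times V$ such that $$ {\bf det} \left(\frac{\partial}{\partial \xi} - \frac{\partial}{\partial \zeta} \right)^k {\bf det}( \xi)^{\lambda'+k}\, {\bf det} ( \zeta)^{\mu'+k} = c^{(k)}_{\lambda',\mu'}( \xi,\zeta)\,{\bf det} ( \xi)^{\lambda'}\, {\bf det}( \zeta)^{\mu'} $$ for all $\xi,\zeta\in V$ with ${\bf det}(\xi)>0$, ${\bf det}(\zeta)>0$.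
   Context: $V$ is a simple real Jordan algebra with unit, dimension $n$; its rank $r$ is the degree of the generic minimal polynomial $\lambda^r-a_1(x)\lambda^{r-1}+\cdots+(-1)^ra_r(x)$; $\operatorname{tr}=a_1$, ${\bf det}=a_r$, $\tau(x,y)=\operatorname{tr}(xy)$ (nondegenerate). $V^\times$ is the set of invertible elements. For $x\in V^\times$, ${\bf det}(x)^{s,+}=|{\bf det}(x)|^s$, ${\bf det}(x)^{s,-}=\operatorname{sign}({\bf det}(x))|{\bf det}(x)|^s$. ${\bf det}(\frac{\partial}{\partial\xi}-\frac{\partial}{\partial\zeta})$ is the constant coefficient differential operator on $V\times V$ with ${\bf det}(\frac{\partial}{\partial\xi}-\frac{\partial}{\partial\zeta})e^{\tau(\xi,x)+\tau(\zeta,y)}={\bf det}(x-y)e^{\tau(\xi,x)+\tau(\zeta,y)}$ for all $x,y\in V$. For $s,t\in\mathbb C$, $D_{s,t}$ is the unique differential operator with polynomial coefficients on $V\times V$, in variables $(\xi,\zeta)$, such that on $V^\times\times V^\times$, for $\varepsilon,\eta\in\{\pm\}$, ${\bf det}(\frac{\partial}{\partial \xi}-\frac{\partial}{\partial \zeta})\circ {\bf det} (\xi)^{s,\varepsilon}{\bf det} (\zeta)^{t,\eta} ={\bf det} (\xi)^{s-1,-\varepsilon}{\bf det}( \zeta)^{t-1,-\eta}\circ D_{s,t}$ (it exists, with coefficients polynomial in $(s,t)$). The source operator $F_{\lambda,\mu}$ is the differential operator with polynomial coefficients on $V\times V$, in variables $(x,y)$, determined by $$F_{\lambda,\mu}\,e^{i(\tau(x,\xi)+\tau(y,\zeta))}=D_{\lambda-\frac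 nr+1,\ \mu-\frac nr+1}\,e^{i(\tau(x,\xi)+\tau(y,\zeta))},$$ $F_{\lambda,\mu}$ acting in $(x,y)$ and $D$ acting in $(\xi,\zeta)$. The restriction operator is $\operatorname{res}(f)(x)=f(x,x)$. The symbol of a bi-differential operator $B:C^\infty(V\times V)\to C^\infty(V)$ with polynomial coefficients is the function $b(x,\xi,\zeta)$ defined by $B\big(e^{i(\tau(x,\xi)+\tau(y,\zeta))}\big)(x)=b(x,\xi,\zeta)\,e^{i(\tau(x,\xi)+\tau(x,\zeta))}$; when $B$ has constant coefficients it does not depend on $x$ and is written $b(\xi,\zeta)$. The operators $B^{(k)}_{\lambda,\mu}$ have constant coefficients. *)

theory Defs
  imports "HOL-Analysis.Analysis" "HOL-Computational_Algebra.Polynomial"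
begin

section \<open>Simple real Jordan algebras\<close>

text \<open>
  The underlying real vector space of dimension n is a type of class \<^class>\<open>euclidean_space\<close>
  with \<open>n = DIM('a)\<close>. Its inner product serves only as an auxiliary choice of topology and of a
  basis; no compatibility with the Jordan product is required, and in particular the algebra
  need not be Euclidean (formally real).
\<close>

definition unital_jordan_algebra :: "('a::euclidean_space \<Rightarrow> 'a \<Rightarrow> 'a) \<Rightarrow> 'a \<Rightarrow> bool" where
  "unital_jordan_algebra mul e \<longleftrightarrow>
     bilinear mul \<and>
     (\<forall>x y. mul x y = mul y x) \<and>
     (\<forall>x y. mul (mul x x) (mul x y) = mul x (mul (mul x x) y)) \<and>
     (\<forall>x. mul e x = x)"

text \<open>The algebra is nonzero because every type of class \<^class>\<open>euclidean_space\<close> has positive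
  dimension.\<close>

definition simple_jordan_algebra :: "('a::euclidean_space \<Rightarrow> 'a \<Rightarrow> 'a) \<Rightarrow> 'a \<Rightarrow> bool" where
  "simple_jordan_algebra mul e \<longleftrightarrow>
     unital_jordan_algebra mul e \<and>
     (\<forall>I. subspace I \<and> (\<forall>x. \<forall>y\<in>I. mul x y \<in> I) \<longrightarrow> I = {0} \<or> I = UNIV)"

primrec jpow :: "('a::euclidean_space \<Rightarrow> 'a \<Rightarrow> 'a) \<Rightarrow> 'a \<Rightarrow> 'a \<Rightarrow> nat \<Rightarrow> 'a" where
  "jpow mul e x 0 = e"
| "jpow mul e x (Suc k) = mul x (jpow mul e x k)"

definition jeval :: "('a::euclidean_space \<Rightarrow> 'a \<Rightarrow> 'a) \<Rightarrow> 'a \<Rightarrow> real poly \<Rightarrow> 'a \<Rightarrow> 'a" where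
  "jeval mul e p x = (\<Sum>i\<le>degree p. coeff p i *\<^sub>R jpow mul e x i)"

definition is_min_poly :: "('a::euclidean_space \<Rightarrow> 'a \<Rightarrow> 'a) \<Rightarrow> 'a \<Rightarrow> 'a \<Rightarrow> real poly \<Rightarrow> bool" where
  "is_min_poly mul e x p \<longleftrightarrow>
     lead_coeff p = 1 \<and> jeval mul e p x = 0 \<and>
     (\<forall>q. lead_coeff q = 1 \<and> jeval mul e q x = 0 \<longrightarrow> degree p \<le> degree q)"

definition jrank :: "('a::euclidean_space \<Rightarrow> 'a \<Rightarrow> 'a) \<Rightarrow> 'a \<Rightarrow> nat" where
  "jrank mul e = Max {degree p | x p. is_min_poly mul e x p}"

text \<open>
  The elements whose minimal polynomial has degree \<open>r = jrank mul e\<close> are the regular (generic)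
  ones. The generic minimal polynomial, in the indeterminate \<open>\<lambda>\<close>, is
  \<open>\<lambda>^r - a 1 x \<lambda>^(r-1) + ... + (-1)^r a r x\<close>, whose coefficients
  \<open>a 1, ..., a r\<close> are the (unique) polynomial functions for which it
  specializes to the minimal polynomial at every regular element.
\<close>

definition generic_min_poly ::
  "('a::euclidean_space \<Rightarrow> 'a \<Rightarrow> 'a) \<Rightarrow> 'a \<Rightarrow> (nat \<Rightarrow> 'a \<Rightarrow> real) \<Rightarrow> bool" where
  "generic_min_poly mul e a \<longleftrightarrow>
     (\<forall>j\<in>{1..jrank mul e}. real_polynomial_function (a j)) \<and>
     (\<forall>x p. is_min_poly mul e x p \<and> degree p = jrank mul e \<longrightarrow>
        p = monom 1 (jrank mul e) +
            (\<Sum>j=1..jrank mul e. monom ((-1) ^ j * a j x) (jrank mul e - j)))"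

definition jtau :: "('a::euclidean_space \<Rightarrow> 'a \<Rightarrow> 'a) \<Rightarrow> (nat \<Rightarrow> 'a \<Rightarrow> real) \<Rightarrow> 'a \<Rightarrow> 'a \<Rightarrow> real" where
  "jtau mul a x y = a 1 (mul x y)"

definition jdet :: "('a::euclidean_space \<Rightarrow> 'a \<Rightarrow> 'a) \<Rightarrow> 'a \<Rightarrow> (nat \<Rightarrow> 'a \<Rightarrow> real) \<Rightarrow> 'a \<Rightarrow> real" where
  "jdet mul e a = a (jrank mul e)"

text \<open>An element is invertible if it has an inverse in the associative subalgebra generated by
  itself and the unit.\<close>

definition jinvertibles :: "('a::euclidean_space \<Rightarrow> 'a \<Rightarrow> 'a) \<Rightarrow> 'a \<Rightarrow> 'a set" where
  "jinvertibles mul e = {x. \<exists>p. mul x (jeval mul e p x) = e}"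

text \<open>The signed powers; the sign \<open>+\<close> is encoded as \<^const>\<open>True\<close>, the sign \<open>-\<close> as \<^const>\<open>False\<close>.\<close>

definition signed_pow :: "complex \<Rightarrow> bool \<Rightarrow> real \<Rightarrow> complex" where
  "signed_pow s \<epsilon> d = (if \<epsilon> then 1 else of_real (sgn d)) * of_real \<bar>d\<bar> powr s"

section \<open>Differential operators with polynomial coefficients\<close>

definition dir_deriv :: "'v::euclidean_space \<Rightarrow> ('v \<Rightarrow> complex) \<Rightarrow> 'v \<Rightarrow> complex" where
  "dir_deriv v f z = frechet_derivative f (at z) v"

primrec iter_deriv :: "'v::euclidean_space list \<Rightarrow> ('v \<Rightarrow> complex) \<Rightarrow> 'v \<Rightarrow> complex" where
  "iter_deriv [] f = f"
| "iter_deriv (v # vs) f = dir_deriv v (iter_deriv vs f)"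

text \<open>For open \<open>U\<close> this says that \<open>f\<close> is of class \<open>C\<^sup>\<infinity>\<close> on \<open>U\<close>.\<close>

definition smooth_at_all :: "'v::euclidean_space set \<Rightarrow> ('v \<Rightarrow> complex) \<Rightarrow> bool" where
  "smooth_at_all U f \<longleftrightarrow>
     (\<forall>vs. set vs \<subseteq> Basis \<longrightarrow> (\<forall>z\<in>U. iter_deriv vs f differentiable (at z)))"

text \<open>
  An operator is given by a finite expression in iterated partial derivatives. The same
  expression is applied to any total function and evaluated pointwise; its value at \<open>z\<close> is
  meaningful as soon as the function is smooth near \<open>z\<close>, and depends only on the germ there.
  So functions defined on an open subset are represented by arbitrary total extensions.
\<close>

definition poly_diff_op :: "(('v::euclidean_space \<Rightarrow> complex) \<Rightarrow> 'v \<Rightarrow> complex) \<Rightarrow> bool" where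
  "poly_diff_op T \<longleftrightarrow>
     (\<exists>I c. finite I \<and> (\<forall>vs\<in>I. set vs \<subseteq> Basis \<and> polynomial_function (c vs)) \<and>
        (\<forall>f z. T f z = (\<Sum>vs\<in>I. c vs z * iter_deriv vs f z)))"

definition const_diff_op :: "(('v::euclidean_space \<Rightarrow> complex) \<Rightarrow> 'v \<Rightarrow> complex) \<Rightarrow> bool" where
  "const_diff_op T \<longleftrightarrow>
     (\<exists>I c. finite I \<and> (\<forall>vs\<in>I. set vs \<subseteq> Basis) \<and>
        (\<forall>f z. T f z = (\<Sum>vs\<in>I. c vs * iter_deriv vs f z)))"

section \<open>The operators of the construction\<close>

text \<open>\<open>P\<close> is the operator \<open>det(d/d\<xi> - d/d\<zeta>)\<close>; a point of \<open>V \<times> V\<close> is written \<open>w = (\<xi>, \<zeta>)\<close>.\<close>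

definition is_det_diff_op ::
  "('a::euclidean_space \<Rightarrow> 'a \<Rightarrow> 'a) \<Rightarrow> 'a \<Rightarrow> (nat \<Rightarrow> 'a \<Rightarrow> real) \<Rightarrow>
   (('a \<times> 'a \<Rightarrow> complex) \<Rightarrow> 'a \<times> 'a \<Rightarrow> complex) \<Rightarrow> bool" where
  "is_det_diff_op mul e a P \<longleftrightarrow>
     const_diff_op P \<and>
     (\<forall>x y \<xi> \<zeta>.
        P (\<lambda>(\<xi>, \<zeta>). of_real (exp (jtau mul a \<xi> x + jtau mul a \<zeta> y))) (\<xi>, \<zeta>) =
          of_real (jdet mul e a (x - y)) * of_real (exp (jtau mul a \<xi> x + jtau mul a \<zeta> y)))"

definition is_D_op ::
  "('a::euclidean_space \<Rightarrow> 'a \<Rightarrow> 'a) \<Rightarrow> 'a \<Rightarrow> (nat \<Rightarrow> 'a \<Rightarrow> real) \<Rightarrow>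
   (('a \<times> 'a \<Rightarrow> complex) \<Rightarrow> 'a \<times> 'a \<Rightarrow> complex) \<Rightarrow> complex \<Rightarrow> complex \<Rightarrow>
   (('a \<times> 'a \<Rightarrow> complex) \<Rightarrow> 'a \<times> 'a \<Rightarrow> complex) \<Rightarrow> bool" where
  "is_D_op mul e a P s t T \<longleftrightarrow>
     poly_diff_op T \<and>
     (\<forall>\<epsilon> \<eta> f. smooth_at_all (jinvertibles mul e \<times> jinvertibles mul e) f \<longrightarrow>
        (\<forall>\<xi>\<in>jinvertibles mul e. \<forall>\<zeta>\<in>jinvertibles mul e.
           P (\<lambda>(\<xi>, \<zeta>). signed_pow s \<epsilon> (jdet mul e a \<xi>) * signed_pow t \<eta> (jdet mul e a \<zeta>) * f (\<xi>, \<zeta>))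
             (\<xi>, \<zeta>) =
           signed_pow (s - 1) (\<not> \<epsilon>) (jdet mul e a \<xi>) * signed_pow (t - 1) (\<not> \<eta>) (jdet mul e a \<zeta>) *
             T f (\<xi>, \<zeta>)))"

text \<open>The exponential \<open>exp (i (\<tau>(x,\<xi>) + \<tau>(y,\<zeta>)))\<close> at \<open>z = (x, y)\<close> and \<open>w = (\<xi>, \<zeta>)\<close>.\<close>

definition plane_wave ::
  "('a::euclidean_space \<Rightarrow> 'a \<Rightarrow> 'a) \<Rightarrow> (nat \<Rightarrow> 'a \<Rightarrow> real) \<Rightarrow> 'a \<times> 'a \<Rightarrow> 'a \<times> 'a \<Rightarrow> complex" where
  "plane_wave mul a z w =
     exp (\<i> * of_real (jtau mul a (fst z) (fst w) + jtau mul a (snd z) (snd w)))"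

definition is_source_op ::
  "('a::euclidean_space \<Rightarrow> 'a \<Rightarrow> 'a) \<Rightarrow> 'a \<Rightarrow> (nat \<Rightarrow> 'a \<Rightarrow> real) \<Rightarrow>
   (complex \<Rightarrow> complex \<Rightarrow> ('a \<times> 'a \<Rightarrow> complex) \<Rightarrow> 'a \<times> 'a \<Rightarrow> complex) \<Rightarrow> complex \<Rightarrow> complex \<Rightarrow>
   (('a \<times> 'a \<Rightarrow> complex) \<Rightarrow> 'a \<times> 'a \<Rightarrow> complex) \<Rightarrow> bool" where
  "is_source_op mul e a D l m T \<longleftrightarrow>
     poly_diff_op T \<and>
     (\<forall>z w. T (\<lambda>z. plane_wave mul a z w) z =
        D (l - of_nat DIM('a) / of_nat (jrank mul e) + 1)
          (m - of_nat DIM('a) / of_nat (jrank mul e) + 1)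
          (\<lambda>w. plane_wave mul a z w) w)"

definition res :: "('a \<times> 'a \<Rightarrow> complex) \<Rightarrow> 'a \<Rightarrow> complex" where
  "res f x = f (x, x)"

text \<open>\<open>F_comp F l m k\<close> is the composition of \<open>F (l+k-1) (m+k-1), ..., F l m\<close>, the last one
  being applied first.\<close>

primrec F_comp ::
  "(complex \<Rightarrow> complex \<Rightarrow> ('a \<times> 'a \<Rightarrow> complex) \<Rightarrow> 'a \<times> 'a \<Rightarrow> complex) \<Rightarrow> complex \<Rightarrow> complex \<Rightarrow>
   nat \<Rightarrow> ('a \<times> 'a \<Rightarrow> complex) \<Rightarrow> 'a \<times> 'a \<Rightarrow> complex" where
  "F_comp F l m 0 = id"
| "F_comp F l m (Suc k) = F (l + of_nat k) (m + of_nat k) \<circ> F_comp F l m k"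

definition B_op ::
  "(complex \<Rightarrow> complex \<Rightarrow> ('a \<times> 'a \<Rightarrow> complex) \<Rightarrow> 'a \<times> 'a \<Rightarrow> complex) \<Rightarrow> complex \<Rightarrow> complex \<Rightarrow>
   nat \<Rightarrow> ('a \<times> 'a \<Rightarrow> complex) \<Rightarrow> 'a \<Rightarrow> complex" where
  "B_op F l m k = res \<circ> F_comp F l m k"

definition bidiff_symbol ::
  "('a::euclidean_space \<Rightarrow> 'a \<Rightarrow> 'a) \<Rightarrow> (nat \<Rightarrow> 'a \<Rightarrow> real) \<Rightarrow>
   (('a \<times> 'a \<Rightarrow> complex) \<Rightarrow> 'a \<Rightarrow> complex) \<Rightarrow> 'a \<Rightarrow> 'a \<Rightarrow> 'a \<Rightarrow> complex" where
  "bidiff_symbol mul a B x \<xi> \<zeta> =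
     B (\<lambda>z. plane_wave mul a z (\<xi>, \<zeta>)) x / plane_wave mul a (x, x) (\<xi>, \<zeta>)"

definition is_c_poly ::
  "('a::euclidean_space \<Rightarrow> 'a \<Rightarrow> 'a) \<Rightarrow> 'a \<Rightarrow> (nat \<Rightarrow> 'a \<Rightarrow> real) \<Rightarrow>
   (('a \<times> 'a \<Rightarrow> complex) \<Rightarrow> 'a \<times> 'a \<Rightarrow> complex) \<Rightarrow> complex \<Rightarrow> complex \<Rightarrow> nat \<Rightarrow>
   ('a \<times> 'a \<Rightarrow> complex) \<Rightarrow> bool" where
  "is_c_poly mul e a P l m k c \<longleftrightarrow>
     polynomial_function c \<and>
     (\<forall>\<xi> \<zeta>. jdet mul e a \<xi> > 0 \<and> jdet mul e a \<zeta> > 0 \<longrightarrow>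
        (P ^^ k)
          (\<lambda>(\<xi>, \<zeta>). of_real (jdet mul e a \<xi>) powr (l + of_nat k) *
                     of_real (jdet mul e a \<zeta>) powr (m + of_nat k)) (\<xi>, \<zeta>) =
        c (\<xi>, \<zeta>) * of_real (jdet mul e a \<xi>) powr l * of_real (jdet mul e a \<zeta>) powr m)"

definition c_poly ::
  "('a::euclidean_space \<Rightarrow> 'a \<Rightarrow> 'a) \<Rightarrow> 'a \<Rightarrow> (nat \<Rightarrow> 'a \<Rightarrow> real) \<Rightarrow>
   (('a \<times> 'a \<Rightarrow> complex) \<Rightarrow> 'a \<times> 'a \<Rightarrow> complex) \<Rightarrow> complex \<Rightarrow> complex \<Rightarrow> nat \<Rightarrow>
   'a \<times> 'a \<Rightarrow> complex" where
  "c_poly mul e a P l m k = (THE c. is_c_poly mul e a P l m k c)"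

end

theory Submission
  imports Defs "HOL-Library.Multiset"
begin

text \<open>
  Write \<open>e z w\<close> for the plane wave. The source operators act on it in \<open>z\<close> as the operators \<open>D\<close> act in
  \<open>w\<close>, and operators in different variables commute, so the composition of \<open>k\<close> source operators takes
  \<open>e z w\<close> to the composition of the \<open>D\<close>'s in the reverse order, applied in \<open>w\<close>. By the
  intertwining relation this reversed composition is \<open>P ^^ k\<close> conjugated by powers of the determinants.
  At \<open>z = (x, x)\<close> the wave is a function of \<open>\<xi> + \<zeta>\<close>, which commutes with \<open>P\<close>; what remains is
  \<open>P ^^ k\<close> applied to the determinant powers. This proves the formula where both determinants are
  positive, a nonempty open set because it contains the unit; both sides being polynomial, it holds
  everywhere.

  Algebraically this needs that the trace form is bilinear and nondegenerate, that \<open>det e > 0\<close> and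
  that elements with nonzero determinant are invertible. All of it is drawn from the Cayley-Hamilton
  identity, which extends from the regular elements by density, by rescaling it and by
  differentiating it along the unit and along inner derivations.
\<close>

section \<open>Smooth functions and iterated derivatives\<close>

text \<open>The obstacle is that \<open>P\<close> is specified only by its values on exponentials of
  \<open>jtau\<close>, while it has to be applied to determinant powers. An operator here is a
  finite sum over lists of directions; different lists may denote the same derivative, and nothing
  fixes the sum itself. Two facts bridge the gap: on smooth functions derivatives commute, so a list
  counts only through its multiset, and independence of monomials then shows that a sum whose symbol
  vanishes at all linear forms annihilates every smooth function. Nondegeneracy of
  \<open>jtau\<close> is what supplies all linear forms. The algebra cannot lean on a spectral
  theorem, since formal reality is not assumed, and the \<open>a j\<close> are known only through
  minimal polynomials of regular elements. There the powers below the rank are independent, so a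
  relation between them splits into one scalar equation per coefficient. The shift by
  \<open>n/r\<close> matches parameters: \<open>F\<close> at \<open>l + j\<close> reads
  \<open>D\<close> at \<open>l' + j + 1\<close> with \<open>l' = l - n/r\<close>, the operator left
  behind when \<open>P\<close> lowers the exponent \<open>l' + j + 1\<close> to
  \<open>l' + j\<close>.\<close>

lemma has_derivative_dir_deriv:
  assumes "(f has_derivative f') (at z)"
  shows "dir_deriv v f z = f' v"
  using frechet_derivative_at[OF assms] by (simp add: dir_deriv_def)

lemma dir_deriv_cong_open:
  assumes "open U" "z \<in> U" "\<And>y. y \<in> U \<Longrightarrow> f y = g y"
  shows "dir_deriv v f z = dir_deriv v g z"
proof -
  have "(f has_derivative f') (at z) \<longleftrightarrow> (g has_derivative f') (at z)" for f'
    using has_derivative_transform_within_open[of f f' z UNIV U g]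
      has_derivative_transform_within_open[of g f' z UNIV U f] assms by metis
  then show ?thesis
    by (simp add: dir_deriv_def frechet_derivative_def)
qed

lemma iter_deriv_cong_open:
  assumes "open U" "z \<in> U" "\<And>y. y \<in> U \<Longrightarrow> f y = g y"
  shows "iter_deriv vs f z = iter_deriv vs g z"
  using assms(2)
proof (induction vs arbitrary: z)
  case (Cons v vs)
  then show ?case
    using dir_deriv_cong_open[OF assms(1) Cons.prems, of "iter_deriv vs f" "iter_deriv vs g"] by simp
qed (use assms in auto)

lemma iter_deriv_append: "iter_deriv (us @ vs) f = iter_deriv us (iter_deriv vs f)"
  by (induction us) auto

lemma differentiable_cong_open:
  assumes "f differentiable (at z)" "open U" "z \<in> U" "\<And>y. y \<in> U \<Longrightarrow> f y = g y"
  shows "g differentiable (at z)"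
proof -
  obtain f' where "(f has_derivative f') (at z)" using assms(1) unfolding differentiable_def by blast
  then have "(g has_derivative f') (at z)"
    by (rule has_derivative_transform_within_open[OF _ assms(2-4)])
  then show ?thesis by (rule differentiableI)
qed

lemma dir_deriv_add:
  assumes "f differentiable (at z)" "g differentiable (at z)"
  shows "dir_deriv v (\<lambda>z. f z + g z) z = dir_deriv v f z + dir_deriv v g z"
  using has_derivative_dir_deriv[OF has_derivative_add[OF assms[unfolded frechet_derivative_works]]]
  by (simp add: dir_deriv_def)

lemma dir_deriv_mult:
  assumes "f differentiable (at z)" "g differentiable (at z)"
  shows "dir_deriv v (\<lambda>z. f z * g z) z = f z * dir_deriv v g z + dir_deriv v f z * g z"
  using has_derivative_dir_deriv[OF has_derivative_mult[OF assms[unfolded frechet_derivative_works]]]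
  by (simp add: dir_deriv_def)

lemma dir_deriv_cmult:
  assumes "f differentiable (at z)"
  shows "dir_deriv v (\<lambda>z. c * f z) z = c * dir_deriv v f z"
  using has_derivative_dir_deriv[OF has_derivative_mult_right[OF assms[unfolded frechet_derivative_works]]]
  by (simp add: dir_deriv_def)

lemma dir_deriv_const [simp]: "dir_deriv v (\<lambda>z. c) z = 0"
  by (simp add: dir_deriv_def)

lemma dir_deriv_sum:
  assumes "finite I" "\<And>i. i \<in> I \<Longrightarrow> f i differentiable (at z)"
  shows "dir_deriv v (\<lambda>z. \<Sum>i\<in>I. f i z) z = (\<Sum>i\<in>I. dir_deriv v (f i) z)"
  using assms
  by (induction I rule: finite_induct) (auto simp: dir_deriv_add)

lemma linear_dir_deriv:
  assumes "f differentiable (at z)"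
  shows "linear (\<lambda>v. dir_deriv v f z)"
  using linear_frechet_derivative[OF assms] by (simp add: dir_deriv_def)

lemma dir_deriv_Basis:
  assumes "f differentiable (at z)"
  shows "dir_deriv v f z = (\<Sum>b\<in>Basis. of_real (v \<bullet> b) * dir_deriv b f z)"
proof -
  interpret L: linear "\<lambda>v. dir_deriv v f z" using assms by (rule linear_dir_deriv)
  have "dir_deriv v f z = dir_deriv (\<Sum>b\<in>Basis. (v \<bullet> b) *\<^sub>R b) f z"
    by (simp add: euclidean_representation)
  then show ?thesis
    by (simp add: L.sum L.scale scaleR_conv_of_real)
qed

text \<open>Constants enter only as generators. A smoothness proof thus reduces to choosing
  generators whose first derivatives stay in the generated algebra.\<close>

inductive_set alg :: "('v \<Rightarrow> complex) set \<Rightarrow> ('v \<Rightarrow> complex) set" for A where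
  gen: "f \<in> A \<Longrightarrow> f \<in> alg A"
| add: "f \<in> alg A \<Longrightarrow> g \<in> alg A \<Longrightarrow> (\<lambda>z. f z + g z) \<in> alg A"
| mult: "f \<in> alg A \<Longrightarrow> g \<in> alg A \<Longrightarrow> (\<lambda>z. f z * g z) \<in> alg A"

text \<open>By the Leibniz rule the derivative of an element of the algebra agrees on
  \<open>U\<close> with another element, hence so does every iterated derivative. Agreement on the
  open set is enough because a derivative depends only on the germ.\<close>

lemma smooth_alg:
  assumes "open U"
    and diff: "\<And>f z. f \<in> A \<Longrightarrow> z \<in> U \<Longrightarrow> f differentiable (at z)"
    and deriv: "\<And>f b. f \<in> A \<Longrightarrow> b \<in> Basis \<Longrightarrow> \<exists>g\<in>alg A. \<forall>z\<in>U. dir_deriv b f z = g z"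
    and "f \<in> alg A"
  shows "smooth_at_all U f"
proof -
  have diff': "f differentiable (at z)" if "f \<in> alg A" "z \<in> U" for f z
    using that by (induction) (auto simp: diff)
  have deriv': "\<exists>g\<in>alg A. \<forall>z\<in>U. dir_deriv b f z = g z" if "f \<in> alg A" "b \<in> Basis" for f b
    using that(1)
  proof induction
    case (gen f) then show ?case using deriv that(2) by blast
  next
    case (add f g)
    then obtain f' g' where *: "f' \<in> alg A" "g' \<in> alg A"
      "\<And>z. z\<in>U \<Longrightarrow> dir_deriv b f z = f' z" "\<And>z. z\<in>U \<Longrightarrow> dir_deriv b g z = g' z" by metis
    show ?case
      by (rule bexI[OF _ alg.add[OF *(1,2)]]) (use add * in \<open>auto simp: dir_deriv_add diff'\<close>)
  next
    case (mult f g)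
    then obtain f' g' where *: "f' \<in> alg A" "g' \<in> alg A"
      "\<And>z. z\<in>U \<Longrightarrow> dir_deriv b f z = f' z" "\<And>z. z\<in>U \<Longrightarrow> dir_deriv b g z = g' z" by metis
    show ?case
      by (rule bexI[OF _ alg.add[OF alg.mult[OF mult(1) *(2)] alg.mult[OF *(1) mult(2)]]])
        (use mult * in \<open>auto simp: dir_deriv_mult diff'\<close>)
  qed
  have "\<exists>g\<in>alg A. \<forall>z\<in>U. iter_deriv vs f z = g z" if "set vs \<subseteq> Basis" for vs
    using that
  proof (induction vs)
    case Nil then show ?case using assms(4) by auto
  next
    case (Cons v vs)
    then obtain g where g: "g \<in> alg A" "\<And>z. z\<in>U \<Longrightarrow> iter_deriv vs f z = g z" by auto
    obtain h where h: "h \<in> alg A" "\<And>z. z\<in>U \<Longrightarrow> dir_deriv v g z = h z"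
      using deriv'[OF g(1), of v] Cons.prems by auto
    have "iter_deriv (v#vs) f z = h z" if "z \<in> U" for z
      using dir_deriv_cong_open[OF assms(1) that g(2), where v=v] h(2)[OF that] by simp
    with h(1) show ?case by blast
  qed
  then show ?thesis
    unfolding smooth_at_all_def by (metis diff' differentiable_cong_open[OF _ assms(1)])
qed

lemma smooth_at_all_differentiable:
  "smooth_at_all U f \<Longrightarrow> z \<in> U \<Longrightarrow> f differentiable (at z)"
  unfolding smooth_at_all_def by (metis empty_iff empty_set iter_deriv.simps(1) subsetI)

lemma smooth_at_all_subset: "smooth_at_all U f \<Longrightarrow> V \<subseteq> U \<Longrightarrow> smooth_at_all V f"
  unfolding smooth_at_all_def by blast

lemma smooth_at_all_cong:
  fixes f :: "'a::euclidean_space \<Rightarrow> complex"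
  assumes "smooth_at_all U f" "open U" "\<And>z. z \<in> U \<Longrightarrow> f z = g z"
  shows "smooth_at_all U g"
  unfolding smooth_at_all_def
proof (intro allI impI ballI)
  fix vs :: "'a list" and z assume "set vs \<subseteq> Basis" and z: "z \<in> U"
  then have "iter_deriv vs f differentiable (at z)" using assms(1) by (auto simp: smooth_at_all_def)
  then show "iter_deriv vs g differentiable (at z)"
    by (rule differentiable_cong_open[OF _ assms(2) z]) (use iter_deriv_cong_open assms in blast)
qed

lemma smooth_at_all_deriv_Basis:
  fixes f :: "'a::euclidean_space \<Rightarrow> complex"
  assumes "smooth_at_all U f" "b \<in> Basis"
  shows "smooth_at_all U (dir_deriv b f)"
  unfolding smooth_at_all_def
proof (intro allI impI ballI)
  fix vs :: "'a list" and z assume "set vs \<subseteq> Basis" "z \<in> U"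
  then have "iter_deriv (vs @ [b]) f differentiable (at z)"
    using assms unfolding smooth_at_all_def by (metis Un_subset_iff set_append empty_subsetI insert_subset list.set(1) list.simps(15))
  then show "iter_deriv vs (dir_deriv b f) differentiable (at z)"
    by (simp add: iter_deriv_append)
qed

lemma smooth_at_all_alg:
  assumes "open U" "f \<in> alg {f. smooth_at_all U f}"
  shows "smooth_at_all U f"
  by (rule smooth_alg[OF assms(1) _ _ assms(2)])
    (auto intro: smooth_at_all_differentiable smooth_at_all_deriv_Basis alg.gen)

lemma smooth_at_all_add:
  "open U \<Longrightarrow> smooth_at_all U f \<Longrightarrow> smooth_at_all U g \<Longrightarrow> smooth_at_all U (\<lambda>z. f z + g z)"
  by (rule smooth_at_all_alg) (auto intro: alg.intros)

lemma smooth_at_all_mult: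
  "open U \<Longrightarrow> smooth_at_all U f \<Longrightarrow> smooth_at_all U g \<Longrightarrow> smooth_at_all U (\<lambda>z. f z * g z)"
  by (rule smooth_at_all_alg) (auto intro: alg.intros)

lemma smooth_at_all_const: "open U \<Longrightarrow> smooth_at_all U (\<lambda>z. c)"
proof (rule smooth_alg[where A="range (\<lambda>c z. c)"])
  fix f :: "'a \<Rightarrow> complex" and b :: 'a assume "f \<in> range (\<lambda>c z. c)"
  then have "dir_deriv b f = (\<lambda>z. 0)" by (auto simp: fun_eq_iff)
  then show "\<exists>g\<in>alg (range (\<lambda>c z. c)). \<forall>z\<in>U. dir_deriv b f z = g z"
    by (intro bexI[of _ "\<lambda>z. 0"] alg.gen) auto
qed (auto intro: alg.gen)

lemma smooth_at_all_sum:
  assumes "open U" "finite I" "\<And>i. i \<in> I \<Longrightarrow> smooth_at_all U (f i)"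
  shows "smooth_at_all U (\<lambda>z. \<Sum>i\<in>I. f i z)"
  using assms(2,3)
  by (induction I rule: finite_induct) (auto intro: smooth_at_all_add smooth_at_all_const assms(1))

text \<open>\<open>smooth_at_all\<close> speaks only of directions in \<open>Basis\<close>;
  linearity of the derivative in its direction covers the others.\<close>

lemma smooth_at_all_dir_deriv:
  assumes "open U" "smooth_at_all U f"
  shows "smooth_at_all U (dir_deriv v f)"
  by (rule smooth_at_all_cong[of U "\<lambda>z. \<Sum>b\<in>Basis. of_real (v \<bullet> b) * dir_deriv b f z"])
    (auto intro!: smooth_at_all_sum smooth_at_all_mult smooth_at_all_const
      smooth_at_all_deriv_Basis assms dir_deriv_Basis[symmetric] smooth_at_all_differentiable)

lemma smooth_at_all_iter_deriv:
  assumes "open U" "smooth_at_all U f"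
  shows "smooth_at_all U (iter_deriv vs f)"
  by (induction vs) (auto intro: smooth_at_all_dir_deriv assms)

lemma iter_deriv_sum:
  assumes "open U" "finite I" "\<And>i. i \<in> I \<Longrightarrow> smooth_at_all U (f i)" "z \<in> U"
  shows "iter_deriv vs (\<lambda>z. \<Sum>i\<in>I. c i * f i z) z = (\<Sum>i\<in>I. c i * iter_deriv vs (f i) z)"
  using assms(4)
proof (induction vs arbitrary: z)
  case (Cons v vs)
  have d: "iter_deriv vs (f i) differentiable (at z)" if "i \<in> I" for i
    using smooth_at_all_iter_deriv[OF assms(1) assms(3)[OF that]] Cons.prems smooth_at_all_differentiable by blast
  have "iter_deriv (v # vs) (\<lambda>z. \<Sum>i\<in>I. c i * f i z) z
      = dir_deriv v (\<lambda>z. \<Sum>i\<in>I. c i * iter_deriv vs (f i) z) z"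
    using Cons.IH by (auto intro: dir_deriv_cong_open[OF assms(1) Cons.prems])
  also have "\<dots> = (\<Sum>i\<in>I. dir_deriv v (\<lambda>z. c i * iter_deriv vs (f i) z) z)"
    by (rule dir_deriv_sum[OF assms(2)]) (auto intro: d)
  also have "\<dots> = (\<Sum>i\<in>I. c i * iter_deriv (v#vs) (f i) z)"
    by (intro sum.cong refl) (simp add: dir_deriv_cmult d)
  finally show ?case .
qed simp

text \<open>The generators are the exponential together with all smooth functions: differentiating
  the exponential reproduces it with a smooth factor.\<close>

lemma smooth_at_all_exp:
  assumes "open U" "smooth_at_all U f"
  shows "smooth_at_all U (\<lambda>z. exp (f z))"
    and "z \<in> U \<Longrightarrow> dir_deriv v (\<lambda>z. exp (f z)) z = exp (f z) * dir_deriv v f z"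
proof -
  have D: "((\<lambda>z. exp (f z)) has_derivative (\<lambda>h. exp (f z) * frechet_derivative f (at z) h)) (at z)"
    if "z \<in> U" for z
  proof -
    have "(f has_derivative frechet_derivative f (at z)) (at z)"
      using smooth_at_all_differentiable[OF assms(2) that] by (simp add: frechet_derivative_works)
    from has_derivative_compose[OF this, of exp "(*) (exp (f z))"] show ?thesis
      using DERIV_exp[of "f z"] by (simp add: has_field_derivative_def)
  qed
  then show D': "dir_deriv v (\<lambda>z. exp (f z)) z = exp (f z) * dir_deriv v f z" if "z \<in> U" for z v
    using has_derivative_dir_deriv[OF D[OF that], of v] by (simp add: dir_deriv_def)
  show "smooth_at_all U (\<lambda>z. exp (f z))"
  proof (rule smooth_alg[OF assms(1), where A="insert (\<lambda>z. exp (f z)) {f. smooth_at_all U f}"])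
    fix g :: "'a \<Rightarrow> complex" and b :: 'a
    assume g: "g \<in> insert (\<lambda>z. exp (f z)) {f. smooth_at_all U f}" and b: "b \<in> Basis"
    show "\<exists>h\<in>alg (insert (\<lambda>z. exp (f z)) {f. smooth_at_all U f}). \<forall>z\<in>U. dir_deriv b g z = h z"
    proof (cases "smooth_at_all U g")
      case True
      then show ?thesis using b
        by (intro bexI[of _ "dir_deriv b g"]) (auto intro!: alg.gen smooth_at_all_deriv_Basis)
    next
      case False
      then have g': "g = (\<lambda>z. exp (f z))" using g by auto
      have "(\<lambda>z. exp (f z) * dir_deriv b f z) \<in> alg (insert (\<lambda>z. exp (f z)) {f. smooth_at_all U f})"
        by (rule alg.mult; rule alg.gen) (use assms b smooth_at_all_deriv_Basis in auto)
      then show ?thesis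
        by (rule bexI[rotated]) (simp add: g' D')
    qed
  next
    fix g z assume "g \<in> insert (\<lambda>z. exp (f z)) {f. smooth_at_all U f}" "z \<in> U"
    then show "g differentiable (at z)"
      using D smooth_at_all_differentiable by (auto simp: differentiable_def)
  qed (simp add: alg.gen)
qed

lemma has_derivative_of_real_powr:
  assumes "(q has_derivative q') (at z)" "q z > 0"
  shows "((\<lambda>z. of_real (q z) powr s) has_derivative
          (\<lambda>h. s * of_real (q z) powr (s - 1) * of_real (q' h) :: complex)) (at z)"
proof -
  have 1: "((\<lambda>z. complex_of_real (q z)) has_derivative (\<lambda>h. of_real (q' h))) (at z)"
    using assms(1) by (rule has_derivative_of_real)
  have "of_real (q z) \<notin> \<real>\<^sub>\<le>\<^sub>0" using assms(2) by auto
  then have "((\<lambda>w. w powr s) has_field_derivative s * of_real (q z) powr (s - 1)) (at (of_real (q z)))"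
    by (rule has_field_derivative_powr)
  from has_derivative_compose[OF 1 this[unfolded has_field_derivative_def]] show ?thesis
    by simp
qed

text \<open>All exponents are taken as generators at once, because each derivative lowers the
  exponent by one. Positivity of \<open>q\<close> keeps its values off the branch cut.\<close>

lemma smooth_at_all_powr:
  assumes "open U" "smooth_at_all U (\<lambda>z. of_real (q z))" "\<And>z. z \<in> U \<Longrightarrow> q z > 0"
    and "\<And>z. z \<in> U \<Longrightarrow> q differentiable (at z)"
  shows "smooth_at_all U (\<lambda>z. of_real (q z) powr s)"
proof -
  let ?P = "range (\<lambda>s z. complex_of_real (q z) powr s)"
  let ?A = "?P \<union> {f. smooth_at_all U f}"
  have D: "((\<lambda>z. complex_of_real (q z) powr s) has_derivative
      (\<lambda>h. s * of_real (q z) powr (s - 1) * of_real (frechet_derivative q (at z) h))) (at z)"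
    if "z \<in> U" for z s
    using assms that by (intro has_derivative_of_real_powr) (auto simp: frechet_derivative_works)
  have D': "dir_deriv v (\<lambda>z. of_real (q z) powr s) z =
      s * of_real (q z) powr (s - 1) * dir_deriv v (\<lambda>z. of_real (q z)) z" if "z \<in> U" for z v s
  proof -
    have "dir_deriv v (\<lambda>z. of_real (q z)) z = of_real (frechet_derivative q (at z) v)"
      using assms(4)[OF that] unfolding frechet_derivative_works
      by (intro has_derivative_dir_deriv has_derivative_of_real)
    then show ?thesis using has_derivative_dir_deriv[OF D[OF that]] by simp
  qed
  show ?thesis
  proof (rule smooth_alg[OF assms(1), where A="?A"])
    fix g :: "'a \<Rightarrow> complex" and b :: 'a
    assume g: "g \<in> ?A" and b: "b \<in> Basis"
    show "\<exists>h\<in>alg ?A. \<forall>z\<in>U. dir_deriv b g z = h z"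
    proof (cases "smooth_at_all U g")
      case True
      then show ?thesis using b
        by (intro bexI[of _ "dir_deriv b g"]) (auto intro!: alg.gen smooth_at_all_deriv_Basis)
    next
      case False
      then obtain s where s: "g = (\<lambda>z. of_real (q z) powr s)" using g by auto
      have "(\<lambda>z. s * of_real (q z) powr (s - 1) * dir_deriv b (\<lambda>z. of_real (q z)) z) \<in> alg ?A"
        using assms b by (intro alg.mult) (auto intro!: alg.gen smooth_at_all_deriv_Basis smooth_at_all_const)
      then show ?thesis
        by (rule bexI[rotated]) (simp add: s D')
    qed
  next
    fix g z assume "g \<in> ?A" "z \<in> U"
    then show "g differentiable (at z)"
      using D smooth_at_all_differentiable by (auto simp: differentiable_def)
  qed (auto intro: alg.gen)
qed

section \<open>Symmetry of second derivatives\<close>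

lemma second_difference_limit:
  assumes "open U" "z \<in> U" and diff: "\<And>y. y \<in> U \<Longrightarrow> f differentiable (at y)"
    and "dir_deriv u f differentiable (at z)"
  shows "((\<lambda>h. (f (z + h *\<^sub>R u + h *\<^sub>R v) - f (z + h *\<^sub>R u) - f (z + h *\<^sub>R v) + f z) / of_real (h^2))
           \<longlongrightarrow> dir_deriv v (dir_deriv u f) z) (at_right 0)"
proof -
  define g where "g = dir_deriv u f"
  define L where "L = frechet_derivative g (at z)"
  have L: "(g has_derivative L) (at z)"
    using assms(4) by (simp add: L_def g_def frechet_derivative_works)
  interpret L: bounded_linear L using L by (rule has_derivative_bounded_linear)
  have Lv: "dir_deriv v (dir_deriv u f) z = L v" by (simp add: dir_deriv_def g_def L_def)
  define N where "N = norm u + norm v + 1"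
  have N: "N > 0" by (simp add: N_def add_nonneg_pos)
  obtain \<rho> where \<rho>: "\<rho> > 0" "ball z \<rho> \<subseteq> U" using assms(1,2) openE by blast
  show ?thesis unfolding tendsto_iff
  proof (intro allI impI)
    fix \<epsilon> :: real assume \<epsilon>: "\<epsilon> > 0"
    \<comment> \<open>The derivative of \<open>\<psi>\<close> below is a difference of two
      remainders, each at most \<open>\<delta>1 * (h * N)\<close>; over an interval of length
      \<open>h\<close> they add up to \<open>\<epsilon> / 2 * h^2\<close>, whence the factor
      4.\<close>
    define \<delta>1 where "\<delta>1 = \<epsilon> / (4 * N)"
    have "\<delta>1 > 0" using \<epsilon> N by (simp add: \<delta>1_def)
    then obtain d where d: "d > 0" "\<And>y. norm (y - z) < d \<Longrightarrow> norm (g y - g z - L (y - z)) \<le> \<delta>1 * norm (y - z)"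
      using L unfolding has_derivative_at_alt by blast
    define h0 where "h0 = min d \<rho> / N"
    have h0: "h0 > 0" using d \<rho> N by (simp add: h0_def)
    have key: "dist ((f (z + h *\<^sub>R u + h *\<^sub>R v) - f (z + h *\<^sub>R u) - f (z + h *\<^sub>R v) + f z) / of_real (h^2)) (L v) < \<epsilon>"
      if h: "0 < h" "h < h0" for h
    proof -
      have hN: "h * N < min d \<rho>" using h N by (simp add: h0_def field_simps)
      have nb: "norm (s *\<^sub>R u + t *\<^sub>R v) \<le> h * N" if "0 \<le> s" "s \<le> h" "0 \<le> t" "t \<le> h" for s t
      proof -
        have "norm (s *\<^sub>R u + t *\<^sub>R v) \<le> s * norm u + t * norm v"
          using norm_triangle_ineq[of "s *\<^sub>R u" "t *\<^sub>R v"] that by simp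
        also have "\<dots> \<le> h * norm u + h * norm v"
          using that by (intro add_mono mult_right_mono) auto
        also have "\<dots> \<le> h * N" using h by (simp add: N_def algebra_simps)
        finally show ?thesis .
      qed
      have inU: "z + s *\<^sub>R u + t *\<^sub>R v \<in> U" if "0 \<le> s" "s \<le> h" "0 \<le> t" "t \<le> h" for s t
      proof -
        have "norm (s *\<^sub>R u + t *\<^sub>R v) < \<rho>" using nb[OF that] hN by linarith
        then have "dist (z + (s *\<^sub>R u + t *\<^sub>R v)) z < \<rho>" by (simp add: dist_norm)
        then have "z + s *\<^sub>R u + t *\<^sub>R v \<in> ball z \<rho>"
          by (simp add: dist_commute add.assoc)
        then show ?thesis using \<rho> by blast
      qed
      have gb: "norm (g (z + s *\<^sub>R u + t *\<^sub>R v) - g z - L (s *\<^sub>R u + t *\<^sub>R v)) \<le> \<delta>1 * (h * N)"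
        if "0 \<le> s" "s \<le> h" "0 \<le> t" "t \<le> h" for s t
      proof -
        have n: "norm ((z + s *\<^sub>R u + t *\<^sub>R v) - z) \<le> h * N" using nb[OF that] by (simp add: add.assoc)
        then have "norm ((z + s *\<^sub>R u + t *\<^sub>R v) - z) < d" using hN by linarith
        from d(2)[OF this] have "norm (g (z + s *\<^sub>R u + t *\<^sub>R v) - g z - L (s *\<^sub>R u + t *\<^sub>R v))
          \<le> \<delta>1 * norm ((z + s *\<^sub>R u + t *\<^sub>R v) - z)" by (simp add: add.assoc)
        also have "\<dots> \<le> \<delta>1 * (h * N)" using n \<open>\<delta>1 > 0\<close> by (intro mult_left_mono) auto
        finally show ?thesis .
      qed
      \<comment> \<open>The linear term is subtracted so that the derivative of
        \<open>\<psi>\<close> becomes a difference of two first-order remainders of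
        \<open>g\<close>. The mean value inequality then bounds \<open>\<psi> h - \<psi> 0\<close>,
        which is the second difference minus \<open>h^2\<close> times \<open>L v\<close>.\<close>
      define \<psi> where "\<psi> s = f (z + s *\<^sub>R u + h *\<^sub>R v) - f (z + s *\<^sub>R u) - s *\<^sub>R L (h *\<^sub>R v)" for s
      have der: "((\<lambda>s. f (z + s *\<^sub>R u + t *\<^sub>R v)) has_derivative
          (\<lambda>k. k *\<^sub>R g (z + s *\<^sub>R u + t *\<^sub>R v))) (at s within {0..h})"
        if "0 \<le> s" "s \<le> h" "0 \<le> t" "t \<le> h" for s t
      proof -
        let ?y = "z + s *\<^sub>R u + t *\<^sub>R v"
        have fd: "(f has_derivative frechet_derivative f (at ?y)) (at ?y)"
          using diff[OF inU[OF that]] by (simp add: frechet_derivative_works)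
        have "((\<lambda>s. z + s *\<^sub>R u + t *\<^sub>R v) has_derivative (\<lambda>k. k *\<^sub>R u)) (at s within {0..h})"
          by (auto intro!: derivative_eq_intros)
        from has_derivative_compose[OF this fd]
        show ?thesis
          using linear_frechet_derivative[OF diff[OF inU[OF that]]]
          by (simp add: g_def dir_deriv_def linear_scale)
      qed
      have der\<psi>: "(\<psi> has_derivative (\<lambda>k. k *\<^sub>R (g (z + s *\<^sub>R u + h *\<^sub>R v) - g (z + s *\<^sub>R u) - L (h *\<^sub>R v)))) (at s within {0..h})"
        if "s \<in> {0..h}" for s
        unfolding \<psi>_def using der[of s h] der[of s 0] that h
        by (auto intro!: derivative_eq_intros simp: algebra_simps)
      have bd: "onorm (\<lambda>k. k *\<^sub>R (g (z + s *\<^sub>R u + h *\<^sub>R v) - g (z + s *\<^sub>R u) - L (h *\<^sub>R v))) \<le> 2 * \<delta>1 * (h * N)"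
        if "s \<in> {0..h}" for s
      proof (rule onorm_bound)
        show "0 \<le> 2 * \<delta>1 * (h * N)" using \<open>\<delta>1 > 0\<close> h N by simp
        have e: "g (z + s *\<^sub>R u + h *\<^sub>R v) - g (z + s *\<^sub>R u) - L (h *\<^sub>R v)
          = (g (z + s *\<^sub>R u + h *\<^sub>R v) - g z - L (s *\<^sub>R u + h *\<^sub>R v)) - (g (z + s *\<^sub>R u + 0 *\<^sub>R v) - g z - L (s *\<^sub>R u + 0 *\<^sub>R v))"
          by (simp add: L.add)
        have "norm (g (z + s *\<^sub>R u + h *\<^sub>R v) - g (z + s *\<^sub>R u) - L (h *\<^sub>R v)) \<le> 2 * \<delta>1 * (h * N)"
          unfolding e using gb[of s h] gb[of s 0] that h
          by (intro order_trans[OF norm_triangle_ineq4]) auto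
        then show "norm (k *\<^sub>R (g (z + s *\<^sub>R u + h *\<^sub>R v) - g (z + s *\<^sub>R u) - L (h *\<^sub>R v))) \<le> 2 * \<delta>1 * (h * N) * norm k" for k
          by (simp add: mult.commute mult_left_mono)
      qed
      have "norm (\<psi> h - \<psi> 0) \<le> 2 * \<delta>1 * (h * N) * norm (h - 0)"
        by (rule differentiable_bound[OF convex_real_interval(5) der\<psi> bd]) (use h in auto)
      also have "\<dots> = \<epsilon> / 2 * h\<^sup>2" using h N by (simp add: \<delta>1_def power2_eq_square field_simps)
      also have "\<dots> < \<epsilon> * h\<^sup>2" using \<epsilon> h by simp
      finally have *: "norm (\<psi> h - \<psi> 0) < \<epsilon> * h\<^sup>2" .
      have "(f (z + h *\<^sub>R u + h *\<^sub>R v) - f (z + h *\<^sub>R u) - f (z + h *\<^sub>R v) + f z) / of_real (h^2) - L v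
        = (\<psi> h - \<psi> 0) / of_real (h\<^sup>2)"
        using h by (simp add: \<psi>_def L.scale scaleR_conv_of_real power2_eq_square field_simps)
      then have "dist ((f (z + h *\<^sub>R u + h *\<^sub>R v) - f (z + h *\<^sub>R u) - f (z + h *\<^sub>R v) + f z) / of_real (h^2)) (L v)
        = norm (\<psi> h - \<psi> 0) / h\<^sup>2"
        by (simp add: dist_norm norm_divide norm_power)
      also have "\<dots> < \<epsilon>" using * h by (simp add: field_simps)
      finally show ?thesis .
    qed
    show "\<forall>\<^sub>F h in at_right 0. dist ((f (z + h *\<^sub>R u + h *\<^sub>R v) - f (z + h *\<^sub>R u) - f (z + h *\<^sub>R v) + f z) / of_real (h^2))
       (dir_deriv v (dir_deriv u f) z) < \<epsilon>"
      unfolding Lv eventually_at_right_field using key h0 by blast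
  qed
qed

text \<open>Both sides are limits of the same second difference quotient, which is symmetric in
  \<open>u\<close> and \<open>v\<close>.\<close>

lemma dir_deriv_commute:
  assumes "open U" "smooth_at_all U f" "z \<in> U"
  shows "dir_deriv v (dir_deriv u f) z = dir_deriv u (dir_deriv v f) z"
proof -
  have d: "f differentiable (at y)" if "y \<in> U" for y
    using assms(2) that by (rule smooth_at_all_differentiable)
  have d': "dir_deriv w f differentiable (at z)" for w
    using smooth_at_all_dir_deriv[OF assms(1,2)] assms(3) by (rule smooth_at_all_differentiable)
  have swap: "f (z + h *\<^sub>R v + h *\<^sub>R u) - f (z + h *\<^sub>R v) - f (z + h *\<^sub>R u) + f z
      = f (z + h *\<^sub>R u + h *\<^sub>R v) - f (z + h *\<^sub>R u) - f (z + h *\<^sub>R v) + f z" for h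
    by (simp add: add.assoc add.commute[of "h *\<^sub>R v"])
  show ?thesis
    using tendsto_unique[OF _ second_difference_limit[OF assms(1,3) d d', where u=u and v=v]
        second_difference_limit[OF assms(1,3) d d', where u=v and v=u, unfolded swap]]
    by simp
qed

section \<open>Constant coefficient operators and their symbols\<close>

lemma iter_deriv_move_front:
  assumes "open U" "smooth_at_all U f" "z \<in> U"
  shows "iter_deriv (xs @ a # ys) f z = iter_deriv (a # xs @ ys) f z"
  using assms(3)
proof (induction xs arbitrary: z)
  case (Cons x xs)
  have "dir_deriv x (iter_deriv (xs @ a # ys) f) z = dir_deriv x (iter_deriv (a # xs @ ys) f) z"
    by (rule dir_deriv_cong_open[OF assms(1) Cons.prems Cons.IH])
  then have "iter_deriv ((x # xs) @ a # ys) f z = dir_deriv x (dir_deriv a (iter_deriv (xs @ ys) f)) z"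
    by simp
  also have "\<dots> = dir_deriv a (dir_deriv x (iter_deriv (xs @ ys) f)) z"
    by (rule dir_deriv_commute[OF assms(1) smooth_at_all_iter_deriv[OF assms(1,2)] Cons.prems])
  finally show ?case by simp
qed simp

text \<open>Any entry can be moved to the front, so lists of directions behave like commutative
  monomials, the multiset being the exponent vector.\<close>

lemma iter_deriv_mset:
  assumes "open U" "smooth_at_all U f" "z \<in> U" "mset us = mset vs"
  shows "iter_deriv us f z = iter_deriv vs f z"
  using assms(3,4)
proof (induction vs arbitrary: us z)
  case (Cons a vs)
  then have "a \<in> set us" using mset_eq_setD[OF Cons.prems(2)] by simp
  then obtain xs ys where us: "us = xs @ a # ys" by (meson split_list)
  have "mset (xs @ ys) = mset vs" using Cons.prems(2) us by simp
  then have "iter_deriv (xs @ ys) f y = iter_deriv vs f y" if "y \<in> U" for y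
    using Cons.IH that by blast
  then have "dir_deriv a (iter_deriv (xs @ ys) f) z = dir_deriv a (iter_deriv vs f) z"
    by (rule dir_deriv_cong_open[OF assms(1) Cons.prems(1)])
  then show ?case
    unfolding us iter_deriv_move_front[OF assms(1,2) Cons.prems(1)] by simp
qed simp

section \<open>Vanishing symbols and vanishing operators\<close>

lemma monomials_independent_one:
  fixes b :: "'i \<Rightarrow> complex" and k :: "'i \<Rightarrow> nat"
  assumes "finite I" "\<And>x::real. (\<Sum>i\<in>I. b i * of_real x ^ k i) = 0"
  shows "(\<Sum>i | i \<in> I \<and> k i = j. b i) = 0"
proof -
  define p where "p = (\<Sum>i\<in>I. monom (b i) (k i))"
  have "poly p (of_real x) = 0" for x :: real
    using assms(2)[of x] by (simp add: p_def poly_sum poly_monom)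
  then have "range complex_of_real \<subseteq> {z. poly p z = 0}" by auto
  moreover have "infinite (range complex_of_real)"
    using finite_imageD[OF _ inj_of_real] infinite_UNIV_char_0 by blast
  ultimately have "p = 0" using poly_roots_finite[of p] finite_subset by blast
  then have "0 = coeff p j" by simp
  also have "\<dots> = (\<Sum>i\<in>I. if k i = j then b i else 0)"
    by (simp add: p_def coeff_sum)
  also have "\<dots> = (\<Sum>i | i \<in> I \<and> k i = j. b i)"
    using assms(1) by (simp add: sum.inter_filter)
  finally show ?thesis by simp
qed

text \<open>Exponents may repeat among the indices, so only the sums over equal exponents vanish.
  The induction freezes all variables but one and compares coefficients in that variable.\<close>

lemma monomials_independent:
  fixes c :: "'i \<Rightarrow> complex" and k :: "'i \<Rightarrow> 'v \<Rightarrow> nat"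
  assumes "finite A" "finite I"
    and "\<And>t::'v \<Rightarrow> real. (\<Sum>i\<in>I. c i * (\<Prod>v\<in>A. of_real (t v) ^ k i v)) = 0"
  shows "(\<Sum>i | i \<in> I \<and> (\<forall>v\<in>A. k i v = \<kappa> v). c i) = 0"
  using assms
proof (induction A arbitrary: I rule: finite_induct)
  case empty
  then show ?case by simp
next
  case (insert a A)
  define J where "J = {i \<in> I. k i a = \<kappa> a}"
  have "(\<Sum>i\<in>J. c i * (\<Prod>v\<in>A. of_real (t v) ^ k i v)) = 0" for t :: "'v \<Rightarrow> real"
    unfolding J_def
  proof (rule monomials_independent_one[OF insert.prems(1)])
    fix x :: real
    have e: "(\<Prod>v\<in>A. complex_of_real ((t(a := x)) v) ^ k i v) = (\<Prod>v\<in>A. of_real (t v) ^ k i v)" for i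
      using insert.hyps by (intro prod.cong) auto
    show "(\<Sum>i\<in>I. c i * (\<Prod>v\<in>A. of_real (t v) ^ k i v) * of_real x ^ k i a) = 0"
      using insert.prems(2)[of "t(a := x)"]
      by (simp only: prod.insert[OF insert.hyps] e) (simp add: mult_ac)
  qed
  then have "(\<Sum>i | i \<in> J \<and> (\<forall>v\<in>A. k i v = \<kappa> v). c i) = 0"
    using insert.prems(1) by (intro insert.IH) (auto simp: J_def)
  then show ?case by (simp add: J_def conj_ac)
qed

text \<open>Terms are grouped by the multiset of their directions. All derivatives in a group
  coincide, and the group's total coefficient is a coefficient of the vanishing symbol.\<close>

lemma const_coeff_zero_Basis:
  fixes u :: "'i \<Rightarrow> 'v::euclidean_space list"
  assumes "finite I" "\<And>i. i \<in> I \<Longrightarrow> set (u i) \<subseteq> Basis"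
    and sym: "\<And>\<eta>. linear \<eta> \<Longrightarrow> (\<Sum>i\<in>I. c i * (\<Prod>v\<leftarrow>u i. complex_of_real (\<eta> v))) = 0"
    and "open U" "smooth_at_all U f" "z \<in> U"
  shows "(\<Sum>i\<in>I. c i * iter_deriv (u i) f z) = 0"
proof -
  have prod: "(\<Prod>v\<leftarrow>vs. complex_of_real (t v)) = (\<Prod>v\<in>Basis. of_real (t v) ^ count (mset vs) v)"
    if "set vs \<subseteq> Basis" for vs :: "'v list" and t
    using that
  proof (induction vs)
    case (Cons a vs)
    have "(\<Prod>v\<in>Basis. complex_of_real (t v) ^ count (mset (a # vs)) v)
        = (\<Prod>v\<in>Basis. (if v = a then of_real (t a) else 1) * of_real (t v) ^ count (mset vs) v)"
      by (intro prod.cong refl) auto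
    also have "\<dots> = of_real (t a) * (\<Prod>v\<in>Basis. of_real (t v) ^ count (mset vs) v)"
      using Cons.prems by (subst prod.distrib) simp
    finally show ?case using Cons by simp
  qed simp
  have zero: "(\<Sum>i\<in>I. c i * (\<Prod>v\<in>Basis. of_real (t v) ^ count (mset (u i)) v)) = 0" for t :: "'v \<Rightarrow> real"
  proof -
    \<comment> \<open>A linear form takes arbitrary values \<open>t\<close> on the basis, so the
      symbol vanishes as a polynomial in independent real variables.\<close>
    define \<eta> where "\<eta> v = (\<Sum>b\<in>Basis. (v \<bullet> b) * t b)" for v :: 'v
    have "linear \<eta>"
      by (rule linearI) (simp_all add: \<eta>_def inner_add_left sum.distrib sum_distrib_left algebra_simps)
    moreover have "\<eta> b = t b" if "b \<in> Basis" for b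
    proof -
      have "\<eta> b = (\<Sum>b'\<in>Basis. if b' = b then t b' else 0)"
        unfolding \<eta>_def using that by (intro sum.cong refl) (auto simp: inner_Basis)
      then show ?thesis using that by simp
    qed
    then have "(\<Prod>v\<leftarrow>u i. complex_of_real (\<eta> v)) = (\<Prod>v\<in>Basis. of_real (t v) ^ count (mset (u i)) v)"
      if "i \<in> I" for i
      using assms(2)[OF that] by (simp add: prod)
    ultimately show ?thesis using sym[of \<eta>] by simp
  qed
  have fibre: "(\<Sum>i | i \<in> I \<and> mset (u i) = M. c i) = 0" if "M \<in> (\<lambda>i. mset (u i)) ` I" for M
  proof -
    have M: "set_mset M \<subseteq> Basis" using that assms(2) by fastforce
    have "mset (u i) = M \<longleftrightarrow> (\<forall>v\<in>Basis. count (mset (u i)) v = count M v)" if "i \<in> I" for i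
    proof
      assume r: "\<forall>v\<in>Basis. count (mset (u i)) v = count M v"
      show "mset (u i) = M"
      proof (rule multiset_eqI)
        fix v
        show "count (mset (u i)) v = count M v"
        proof (cases "v \<in> Basis")
          case False
          then have "v \<notin># M" "v \<notin># mset (u i)" using M assms(2)[OF that] by auto
          then show ?thesis by (simp only: not_in_iff)
        qed (use r in blast)
      qed
    qed simp
    then have "{i. i \<in> I \<and> mset (u i) = M} = {i. i \<in> I \<and> (\<forall>v\<in>Basis. count (mset (u i)) v = count M v)}"
      by blast
    then show ?thesis using monomials_independent[OF finite_Basis assms(1) zero, of "count M"] by simp
  qed
  have "(\<Sum>i\<in>I. c i * iter_deriv (u i) f z)
      = (\<Sum>M\<in>(\<lambda>i. mset (u i)) ` I. \<Sum>i | i \<in> I \<and> mset (u i) = M. c i * iter_deriv (u i) f z)"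
    by (rule sum.image_gen[OF assms(1)])
  also have "\<dots> = 0"
  proof (rule sum.neutral, rule ballI)
    fix M assume M: "M \<in> (\<lambda>i. mset (u i)) ` I"
    then obtain j where j: "mset (u j) = M" by blast
    have "(\<Sum>i | i \<in> I \<and> mset (u i) = M. c i * iter_deriv (u i) f z)
        = (\<Sum>i | i \<in> I \<and> mset (u i) = M. c i * iter_deriv (u j) f z)"
      using j by (intro sum.cong refl) (auto intro: iter_deriv_mset[OF assms(4-6)])
    also have "\<dots> = 0" using fibre[OF M] by (simp flip: sum_distrib_right)
    finally show "(\<Sum>i | i \<in> I \<and> mset (u i) = M. c i * iter_deriv (u i) f z) = 0" .
  qed
  finally show ?thesis .
qed

text \<open>Index set for writing an iterated derivative in \<open>n\<close> arbitrary directions by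
  multilinearity in basis directions; \<open>expansion_coeff\<close> below gives the matching
  coefficients.\<close>

definition expansion :: "nat \<Rightarrow> 'v::euclidean_space list set" where
  "expansion n = {bs. set bs \<subseteq> Basis \<and> length bs = n}"

lemma expansion_0 [simp]: "expansion 0 = {[]}"
  by (auto simp: expansion_def)

lemma finite_expansion: "finite (expansion n)"
  unfolding expansion_def by (rule finite_lists_length_eq[OF finite_Basis])

definition expansion_coeff :: "'v::euclidean_space list \<Rightarrow> 'v list \<Rightarrow> complex" where
  "expansion_coeff vs bs = (\<Prod>(v, b)\<leftarrow>zip vs bs. of_real (v \<bullet> b))"

lemma sum_expansion_Suc:
  fixes h :: "'v::euclidean_space list \<Rightarrow> complex"
  shows "(\<Sum>bs\<in>expansion (Suc n). h bs) = (\<Sum>b\<in>Basis. \<Sum>bs\<in>expansion n. h (b # bs))"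
proof -
  have "expansion (Suc n) = (\<lambda>(b :: 'v, bs). b # bs) ` (Basis \<times> expansion n)"
    unfolding expansion_def by (auto simp: length_Suc_conv image_iff)
  moreover have "inj_on (\<lambda>(b :: 'v, bs). b # bs) (Basis \<times> expansion n)"
    by (auto simp: inj_on_def)
  ultimately show ?thesis
    by (simp add: sum.reindex sum.cartesian_product case_prod_unfold)
qed

lemma iter_deriv_expansion:
  assumes "open U" "smooth_at_all U f" "z \<in> U"
  shows "iter_deriv vs f z = (\<Sum>bs\<in>expansion (length vs). expansion_coeff vs bs * iter_deriv bs f z)"
  using assms(3)
proof (induction vs arbitrary: z)
  case Nil
  then show ?case by (simp add: expansion_coeff_def)
next
  case (Cons v vs)
  have d: "iter_deriv us f differentiable (at z)" for us
    using smooth_at_all_differentiable[OF smooth_at_all_iter_deriv[OF assms(1,2)] Cons.prems] .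
  have "iter_deriv (v # vs) f z
      = dir_deriv v (\<lambda>z. \<Sum>bs\<in>expansion (length vs). expansion_coeff vs bs * iter_deriv bs f z) z"
    using dir_deriv_cong_open[OF assms(1) Cons.prems Cons.IH] by simp
  also have "\<dots> = (\<Sum>bs\<in>expansion (length vs). expansion_coeff vs bs * dir_deriv v (iter_deriv bs f) z)"
    by (subst dir_deriv_sum) (auto simp: finite_expansion dir_deriv_cmult d)
  also have "\<dots> = (\<Sum>bs\<in>expansion (length vs). \<Sum>b\<in>Basis.
      expansion_coeff (v # vs) (b # bs) * iter_deriv (b # bs) f z)"
    by (subst dir_deriv_Basis[OF d]) (simp add: expansion_coeff_def sum_distrib_left mult_ac)
  also have "\<dots> = (\<Sum>bs\<in>expansion (length (v # vs)). expansion_coeff (v # vs) bs * iter_deriv bs f z)"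
    by (simp add: sum_expansion_Suc del: iter_deriv.simps) (rule sum.swap)
  finally show ?case .
qed

lemma prod_list_expansion:
  assumes "linear \<eta>"
  shows "(\<Prod>v\<leftarrow>vs. complex_of_real (\<eta> v))
    = (\<Sum>bs\<in>expansion (length vs). expansion_coeff vs bs * (\<Prod>v\<leftarrow>bs. complex_of_real (\<eta> v)))"
proof (induction vs)
  case Nil
  then show ?case by (simp add: expansion_coeff_def)
next
  case (Cons v vs)
  interpret linear \<eta> by fact
  have "\<eta> v = \<eta> (\<Sum>b\<in>Basis. (v \<bullet> b) *\<^sub>R b)" by (simp add: euclidean_representation)
  then have v: "\<eta> v = (\<Sum>b\<in>Basis. (v \<bullet> b) * \<eta> b)" by (simp add: sum scale)
  have "(\<Prod>v\<leftarrow>v # vs. complex_of_real (\<eta> v)) = (\<Sum>b\<in>Basis. of_real (v \<bullet> b) * of_real (\<eta> b)) *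
     (\<Sum>bs\<in>expansion (length vs). expansion_coeff vs bs * (\<Prod>v\<leftarrow>bs. complex_of_real (\<eta> v)))"
    using Cons v by simp
  also have "\<dots> = (\<Sum>b\<in>Basis. \<Sum>bs\<in>expansion (length vs).
      expansion_coeff (v # vs) (b # bs) * (\<Prod>v\<leftarrow>b # bs. complex_of_real (\<eta> v)))"
    by (simp add: sum_product expansion_coeff_def mult_ac)
  also have "\<dots> = (\<Sum>bs\<in>expansion (length (v # vs)). expansion_coeff (v # vs) bs * (\<Prod>v\<leftarrow>bs. complex_of_real (\<eta> v)))"
    by (simp add: sum_expansion_Suc)
  finally show ?case .
qed

text \<open>Arbitrary directions occur when \<open>P\<close> is rewritten with directions
  \<open>(v, -v)\<close>. The derivative and the symbol expand over basis lists with the same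
  coefficients, which reduces the claim to \<open>const_coeff_zero_Basis\<close>.\<close>

lemma const_coeff_zero:
  fixes u :: "'i \<Rightarrow> 'v::euclidean_space list"
  assumes "finite I"
    and sym: "\<And>\<eta>. linear \<eta> \<Longrightarrow> (\<Sum>i\<in>I. c i * (\<Prod>v\<leftarrow>u i. complex_of_real (\<eta> v))) = 0"
    and U: "open U" "smooth_at_all U f" "z \<in> U"
  shows "(\<Sum>i\<in>I. c i * iter_deriv (u i) f z) = 0"
proof -
  let ?J = "Sigma I (\<lambda>i. expansion (length (u i)))"
  have Sigma: "(\<Sum>i\<in>I. \<Sum>bs\<in>expansion (length (u i)). g i bs) = (\<Sum>j\<in>?J. g (fst j) (snd j))"
    for g :: "'i \<Rightarrow> 'v list \<Rightarrow> complex"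
    using assms(1) by (simp add: sum.Sigma finite_expansion case_prod_unfold)
  have "(\<Sum>j\<in>?J. c (fst j) * expansion_coeff (u (fst j)) (snd j) * iter_deriv (snd j) f z) = 0"
  proof (rule const_coeff_zero_Basis[OF _ _ _ U])
    fix \<eta> :: "'v \<Rightarrow> real" assume "linear \<eta>"
    then show "(\<Sum>j\<in>?J. c (fst j) * expansion_coeff (u (fst j)) (snd j) * (\<Prod>v\<leftarrow>snd j. complex_of_real (\<eta> v))) = 0"
      using sym[of \<eta>] by (simp add: prod_list_expansion[of \<eta> "u _"] sum_distrib_left mult.assoc Sigma)
  qed (use assms(1) in \<open>auto simp: finite_expansion, auto simp: expansion_def\<close>)
  then show ?thesis
    by (simp add: iter_deriv_expansion[OF U, of "u _"] sum_distrib_left mult.assoc Sigma)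
qed

section \<open>The generic minimal polynomial and the trace form\<close>

lemma real_polynomial_function_on_line:
  assumes "real_polynomial_function f"
  shows "\<exists>p. \<forall>t. f (x + t *\<^sub>R d) = poly p t"
  using assms
proof induction
  case (linear h)
  interpret bounded_linear h by fact
  show ?case by (intro exI[of _ "[:h x, h d:]"]) (simp add: add scaleR)
next
  case (const c) then show ?case by (intro exI[of _ "[:c:]"]) simp
next
  case (add f g) then show ?case by (metis poly_add)
next
  case (mult f g) then show ?case by (metis poly_mult)
qed

text \<open>On the line from \<open>x\<close> to \<open>u\<close>, \<open>q\<close> restricts to a
  nonzero univariate polynomial whose product with the restriction of \<open>f\<close> has every
  real number as a root. Hence \<open>f\<close> vanishes on the line.\<close>

lemma real_polynomial_function_zero_dense:
  assumes "real_polynomial_function f" "real_polynomial_function q" "q u \<noteq> 0"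
    and zero: "\<And>x. q x \<noteq> 0 \<Longrightarrow> f x = 0"
  shows "f x = 0"
proof -
  obtain p where p: "\<And>t. f (x + t *\<^sub>R (u - x)) = poly p t"
    using real_polynomial_function_on_line[OF assms(1)] by blast
  obtain s where s: "\<And>t. q (x + t *\<^sub>R (u - x)) = poly s t"
    using real_polynomial_function_on_line[OF assms(2)] by blast
  have "poly s 1 \<noteq> 0" using s[of 1] assms(3) by simp
  then have "s \<noteq> 0" by auto
  have "poly (p * s) t = 0" for t
    using zero[of "x + t *\<^sub>R (u - x)"] p s by (cases "poly s t = 0") auto
  then have "p * s = 0" by (intro poly_all_0_iff_0[THEN iffD1]) blast
  then show ?thesis using \<open>s \<noteq> 0\<close> p[of 0] by simp
qed

lemma polynomial_function_bilinear:
  fixes h :: "'b::euclidean_space \<Rightarrow> 'c::euclidean_space \<Rightarrow> 'd::euclidean_space"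
  assumes "bilinear h" "polynomial_function f" "polynomial_function g"
  shows "polynomial_function (\<lambda>x. h (f x) (g x))"
proof -
  have "h (f x) (g x) = (\<Sum>i\<in>Basis. \<Sum>j\<in>Basis. (f x \<bullet> i) *\<^sub>R (g x \<bullet> j) *\<^sub>R h i j)" for x
  proof -
    have "h (f x) (g x) = h (\<Sum>i\<in>Basis. (f x \<bullet> i) *\<^sub>R i) (\<Sum>j\<in>Basis. (g x \<bullet> j) *\<^sub>R j)"
      by (simp add: euclidean_representation)
    then show ?thesis
      by (simp add: bilinear_sum[OF assms(1)] bilinear_lmul[OF assms(1)] bilinear_rmul[OF assms(1)]
          sum.cartesian_product case_prod_unfold mult.commute)
  qed
  moreover have "polynomial_function (\<lambda>x. \<Sum>i\<in>Basis. \<Sum>j\<in>Basis. (f x \<bullet> i) *\<^sub>R (g x \<bullet> j) *\<^sub>R h i j)"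
    using assms(2,3) by (intro polynomial_function_sum polynomial_function_mult polynomial_function_inner) auto
  ultimately show ?thesis by simp
qed

lemma real_polynomial_function_derivative:
  assumes "real_polynomial_function f"
  shows "real_polynomial_function (\<lambda>x. frechet_derivative f (at x) v)"
  using assms
proof induction
  case (linear h)
  then have "frechet_derivative h (at x) = h" for x
    using frechet_derivative_at[OF bounded_linear_imp_has_derivative] by metis
  then show ?case by auto
next
  case (const c) then show ?case by auto
next
  case (add f g)
  have "frechet_derivative (\<lambda>x. f x + g x) (at x) v = frechet_derivative f (at x) v + frechet_derivative g (at x) v" for x
    using frechet_derivative_at[OF has_derivative_add[OF
        differentiable_at_real_polynomial_function[OF add(1), of x UNIV, unfolded frechet_derivative_works]
        differentiable_at_real_polynomial_function[OF add(2), of x UNIV, unfolded frechet_derivative_works]]]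
    by metis
  then show ?case using add.IH by auto
next
  case (mult f g)
  have "frechet_derivative (\<lambda>x. f x * g x) (at x) v
      = f x * frechet_derivative g (at x) v + frechet_derivative f (at x) v * g x" for x
    using frechet_derivative_at[OF has_derivative_mult[OF
        differentiable_at_real_polynomial_function[OF mult(1), of x UNIV, unfolded frechet_derivative_works]
        differentiable_at_real_polynomial_function[OF mult(2), of x UNIV, unfolded frechet_derivative_works]]]
    by metis
  then show ?case using mult by auto
qed

text \<open>Independence of an indexed family: unlike independence of the set of its values, it
  excludes repetitions.\<close>

definition indep_upto :: "nat \<Rightarrow> (nat \<Rightarrow> 'b::real_vector) \<Rightarrow> bool" where
  "indep_upto r v \<longleftrightarrow> (\<forall>c. (\<Sum>i<r. c i *\<^sub>R v i) = 0 \<longrightarrow> (\<forall>i<r. c i = 0))"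

lemma indep_upto_le_DIM:
  fixes v :: "nat \<Rightarrow> 'b::euclidean_space"
  assumes "indep_upto r v"
  shows "r \<le> DIM('b)"
proof -
  have inj: "inj_on v {..<r}"
  proof (rule inj_onI, rule ccontr)
    fix i j assume ij: "i \<in> {..<r}" "j \<in> {..<r}" "v i = v j" "i \<noteq> j"
    define c :: "nat \<Rightarrow> real" where "c k = (if k = i then 1 else 0) - (if k = j then 1 else 0)" for k
    have "(\<Sum>k<r. c k *\<^sub>R v k) = 0"
      using ij by (simp add: c_def scaleR_diff_left sum_subtractf if_distrib[of "\<lambda>x. x *\<^sub>R _"] cong: if_cong)
    then have "c i = 0" using assms ij by (auto simp: indep_upto_def)
    then show False using ij by (simp add: c_def)
  qed
  have "independent (v ` {..<r})"
  proof
    assume "dependent (v ` {..<r})"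
    then obtain c w where c: "w \<in> v ` {..<r}" "c w \<noteq> 0" "(\<Sum>w\<in>v ` {..<r}. c w *\<^sub>R w) = 0"
      by (auto simp: dependent_finite)
    then have "(\<Sum>i<r. c (v i) *\<^sub>R v i) = 0" by (simp add: sum.reindex[OF inj])
    then show False using assms c by (auto simp: indep_upto_def)
  qed
  then have "card (v ` {..<r}) \<le> DIM('b)" using independent_bound by blast
  then show ?thesis using card_image[OF inj] by simp
qed

text \<open>Elimination of one vector at a time, without division.\<close>

lemma indep_upto_generic:
  fixes v :: "nat \<Rightarrow> 'a::euclidean_space \<Rightarrow> 'b::euclidean_space"
  assumes "\<And>i. polynomial_function (v i)" "indep_upto r (\<lambda>i. v i u)"
  shows "\<exists>q. real_polynomial_function q \<and> q u \<noteq> 0 \<and> (\<forall>x. q x \<noteq> 0 \<longrightarrow> indep_upto r (\<lambda>i. v i x))"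
  using assms
proof (induction r arbitrary: v)
  case 0
  show ?case by (intro exI[of _ "\<lambda>x. 1"]) (auto simp: indep_upto_def)
next
  case (Suc r)
  have "v r u \<noteq> 0"
  proof
    assume "v r u = 0"
    then have "(\<Sum>i<Suc r. (if i = r then 1 else 0::real) *\<^sub>R v i u) = 0"
      by (intro sum.neutral) auto
    then show False using Suc.prems(2) unfolding indep_upto_def by fastforce
  qed
  then obtain b where b: "b \<in> Basis" "v r u \<bullet> b \<noteq> 0"
    using euclidean_all_zero_iff by blast
  define v' where "v' i x = (v r x \<bullet> b) *\<^sub>R v i x - (v i x \<bullet> b) *\<^sub>R v r x" for i x
  have eq: "(\<Sum>i<Suc r. (if i < r then c i * (v r x \<bullet> b) else - (\<Sum>i<r. c i * (v i x \<bullet> b))) *\<^sub>R v i x)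
    = (\<Sum>i<r. c i *\<^sub>R v' i x)" for c x
    by (simp add: v'_def scaleR_diff_right sum_subtractf scaleR_sum_left)
  have "indep_upto r (\<lambda>i. v' i u)"
    unfolding indep_upto_def
  proof (intro allI impI)
    fix c i assume c: "(\<Sum>i<r. c i *\<^sub>R v' i u) = 0" and "i < r"
    have "(if i < r then c i * (v r u \<bullet> b) else - (\<Sum>i<r. c i * (v i u \<bullet> b))) = 0"
      using Suc.prems(2)[unfolded indep_upto_def, rule_format, of
          "\<lambda>i. if i < r then c i * (v r u \<bullet> b) else - (\<Sum>i<r. c i * (v i u \<bullet> b))" i]
        c \<open>i < r\<close> unfolding eq by simp
    then show "c i = 0" using b \<open>i < r\<close> by simp
  qed
  moreover have "polynomial_function (v' i)" for i
    unfolding v'_def using Suc.prems(1)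
    by (intro polynomial_function_diff polynomial_function_mult polynomial_function_inner) auto
  ultimately obtain q where q: "real_polynomial_function q" "q u \<noteq> 0"
    "\<And>x. q x \<noteq> 0 \<Longrightarrow> indep_upto r (\<lambda>i. v' i x)" using Suc.IH[of v'] by blast
  have "indep_upto (Suc r) (\<lambda>i. v i x)" if "q x * (v r x \<bullet> b) \<noteq> 0" for x
    unfolding indep_upto_def
  proof (rule allI, rule impI)
    fix c assume c: "(\<Sum>i<Suc r. c i *\<^sub>R v i x) = 0"
    have "v r x \<noteq> 0" using that by auto
    have "(\<Sum>i<r. c i *\<^sub>R v' i x) = (v r x \<bullet> b) *\<^sub>R (\<Sum>i<Suc r. c i *\<^sub>R v i x) - ((\<Sum>i<Suc r. c i *\<^sub>R v i x) \<bullet> b) *\<^sub>R v r x"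
      by (simp add: v'_def scaleR_diff_right sum_subtractf scaleR_sum_right scaleR_sum_left
          inner_sum_left inner_add_left algebra_simps)
    then have "(\<Sum>i<r. c i *\<^sub>R v' i x) = 0" using c by simp
    then have z: "\<forall>i<r. c i = 0" using q(3)[of x] that unfolding indep_upto_def by auto
    then have "c r *\<^sub>R v r x = 0" using c by simp
    then show "\<forall>i<Suc r. c i = 0" using z \<open>v r x \<noteq> 0\<close> by (auto simp: less_Suc_eq)
  qed
  moreover have "real_polynomial_function (\<lambda>x. q x * (v r x \<bullet> b))"
    using q(1) Suc.prems(1)
    by (intro real_polynomial_function.intros(4)) (auto simp: real_polynomial_function_eq)
  ultimately show ?case using q b by (intro exI[of _ "\<lambda>x. q x * (v r x \<bullet> b)"]) auto
qed

section \<open>Powers, rank and the Cayley-Hamilton identity\<close>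

locale jordan =
  fixes mul :: "'a::euclidean_space \<Rightarrow> 'a \<Rightarrow> 'a" and e :: 'a and a :: "nat \<Rightarrow> 'a \<Rightarrow> real"
  assumes simple: "simple_jordan_algebra mul e"
    and gen: "generic_min_poly mul e a"
begin

abbreviation "pw \<equiv> jpow mul e"
abbreviation "ev \<equiv> jeval mul e"
abbreviation "r \<equiv> jrank mul e"

lemma bilin: "bilinear mul"
  and comm: "mul x y = mul y x"
  and jordan_id: "mul (mul x x) (mul x y) = mul x (mul (mul x x) y)"
  and unit [simp]: "mul e x = x"
  and ideal_trivial: "subspace I \<Longrightarrow> (\<And>x y. y \<in> I \<Longrightarrow> mul x y \<in> I) \<Longrightarrow> I = {0} \<or> I = UNIV"
  using simple unfolding simple_jordan_algebra_def unital_jordan_algebra_def by blast+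

lemma unit_right [simp]: "mul x e = x"
  using comm[of x e] by simp

sublocale bounded_bilinear mul
  using bilin by (simp add: bilinear_conv_bounded_bilinear)

lemma e_nonzero: "e \<noteq> 0"
proof
  assume "e = 0"
  obtain b :: 'a where b: "b \<in> Basis" using nonempty_Basis by blast
  have "mul e b = 0" unfolding \<open>e = 0\<close> by (rule zero_left)
  then show False using b by auto
qed

lemma polynomial_function_pw: "polynomial_function (\<lambda>x. pw x k)"
  by (induction k) (auto intro: polynomial_function_bilinear[OF bilin])

lemma ev_eq_sum:
  assumes "degree p \<le> n"
  shows "ev p x = (\<Sum>i\<le>n. coeff p i *\<^sub>R pw x i)"
  unfolding jeval_def using assms
  by (intro sum.mono_neutral_left) (auto intro: ccontr simp: coeff_eq_0)

lemma ev_add: "ev (p + q) x = ev p x + ev q x"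
  by (simp add: ev_eq_sum[of _ "max (degree p) (degree q)"] degree_add_le sum.distrib scaleR_add_left)

lemma ev_0 [simp]: "ev 0 x = 0"
  by (simp add: jeval_def)

lemma ev_monom: "ev (monom c n) x = c *\<^sub>R pw x n"
proof -
  have "ev (monom c n) x = (\<Sum>i\<le>n. (if i = n then c else 0) *\<^sub>R pw x i)"
    by (subst ev_eq_sum[OF degree_monom_le]) (auto intro: sum.cong)
  then show ?thesis by (simp add: if_distrib[of "\<lambda>x. x *\<^sub>R _"] cong: if_cong)
qed

lemma ev_sum: "finite S \<Longrightarrow> ev (\<Sum>i\<in>S. p i) x = (\<Sum>i\<in>S. ev (p i) x)"
  by (induction S rule: finite_induct) (auto simp: ev_add)

lemma ev_smult: "ev (smult c p) x = c *\<^sub>R ev p x"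
  by (simp add: ev_eq_sum[of _ "degree p"] degree_smult_le scaleR_sum_right)

lemma ev_pCons: "ev (pCons c p) x = c *\<^sub>R e + mul x (ev p x)"
proof -
  have "ev (pCons c p) x = (\<Sum>i\<le>Suc (degree p). coeff (pCons c p) i *\<^sub>R pw x i)"
    by (rule ev_eq_sum) (simp add: degree_pCons_le)
  also have "\<dots> = c *\<^sub>R e + (\<Sum>i\<le>degree p. coeff p i *\<^sub>R mul x (pw x i))"
    by (subst sum.atMost_Suc_shift) simp
  also have "\<dots> = c *\<^sub>R e + mul x (ev p x)"
    by (simp add: ev_eq_sum[OF order_refl] sum_right scaleR_right)
  finally show ?thesis .
qed

text \<open>Turns a bound on the degree of the minimal polynomial into independence of powers, a
  condition that \<open>indep_upto_generic\<close> shows to persist wherever some polynomial is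
  nonzero.\<close>

lemma indep_iff_no_annihilator:
  "indep_upto n (pw x) \<longleftrightarrow> (\<forall>p. lead_coeff p = 1 \<and> ev p x = 0 \<longrightarrow> n \<le> degree p)"
proof
  assume n: "indep_upto n (pw x)"
  show "\<forall>p. lead_coeff p = 1 \<and> ev p x = 0 \<longrightarrow> n \<le> degree p"
  proof (intro allI impI, rule ccontr)
    fix p assume p: "lead_coeff p = 1 \<and> ev p x = 0" and "\<not> n \<le> degree p"
    then have deg: "degree p \<le> n - 1" "n > 0" by auto
    have "(\<Sum>i<n. coeff p i *\<^sub>R pw x i) = ev p x"
      using deg by (subst ev_eq_sum[OF deg(1)], intro sum.cong) auto
    then have "coeff p (degree p) = 0"
      using n p \<open>\<not> n \<le> degree p\<close> unfolding indep_upto_def by auto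
    then show False using p by simp
  qed
next
  assume *: "\<forall>p. lead_coeff p = 1 \<and> ev p x = 0 \<longrightarrow> n \<le> degree p"
  show "indep_upto n (pw x)" unfolding indep_upto_def
  proof (rule allI, rule impI, rule ccontr)
    fix c assume c: "(\<Sum>i<n. c i *\<^sub>R pw x i) = 0" and "\<not> (\<forall>i<n. c i = 0)"
    then obtain i where i: "i < n" "c i \<noteq> 0" by auto
    define p where "p = (\<Sum>i<n. monom (c i) i)"
    have coeff: "coeff p j = (if j < n then c j else 0)" for j
      by (simp add: p_def coeff_sum if_distrib cong: if_cong)
    have "p \<noteq> 0" using coeff[of i] i by auto
    have "degree p < n"
      using coeff[of "degree p"] \<open>p \<noteq> 0\<close> by (metis leading_coeff_0_iff)
    have "ev p x = 0" using c by (simp add: p_def ev_sum ev_monom)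
    then have "ev (smult (inverse (lead_coeff p)) p) x = 0" by (simp add: ev_smult)
    moreover have "lead_coeff (smult (inverse (lead_coeff p)) p) = 1" using \<open>p \<noteq> 0\<close> by simp
    ultimately have "n \<le> degree (smult (inverse (lead_coeff p)) p)" using * by blast
    then show False using \<open>degree p < n\<close> \<open>p \<noteq> 0\<close> by simp
  qed
qed

lemma ex_min_poly: "\<exists>p. is_min_poly mul e x p"
proof -
  let ?P = "\<lambda>p. lead_coeff p = 1 \<and> ev p x = 0"
  have "\<not> indep_upto (Suc DIM('a)) (pw x)" using indep_upto_le_DIM by fastforce
  then have "\<exists>p. ?P p" unfolding indep_iff_no_annihilator by blast
  then obtain p where "?P p" "\<And>q. ?P q \<Longrightarrow> degree p \<le> degree q"
    using ex_has_least_nat[of ?P _ degree] by blast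
  then show ?thesis unfolding is_min_poly_def by blast
qed

lemma min_poly_indep:
  assumes "is_min_poly mul e x p"
  shows "indep_upto (degree p) (pw x)"
  using assms unfolding indep_iff_no_annihilator is_min_poly_def by blast

text \<open>The dimension bounds all degrees, so \<open>Max\<close> in the rank is taken over a
  finite nonempty set and is attained.\<close>

lemma min_poly_degree_le: "is_min_poly mul e x p \<Longrightarrow> degree p \<le> r"
  and ex_regular: "\<exists>u. indep_upto r (pw u)"
proof -
  let ?S = "{degree p | x p. is_min_poly mul e x p}"
  have "?S \<subseteq> {..DIM('a)}" using indep_upto_le_DIM[OF min_poly_indep] by auto
  then have fin: "finite ?S" by (rule finite_subset) simp
  then show "is_min_poly mul e x p \<Longrightarrow> degree p \<le> r" unfolding jrank_def by (intro Max_ge) auto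
  have "?S \<noteq> {}" using ex_min_poly by blast
  then have "r \<in> ?S" unfolding jrank_def using fin by (intro Max_in)
  then show "\<exists>u. indep_upto r (pw u)" using min_poly_indep by fastforce
qed

text \<open>Puts the index 1 of the trace into the range where \<open>generic_min_poly\<close>
  constrains \<open>a\<close>. At rank 0 the minimal polynomial would be 1, which evaluates to
  \<open>e\<close>, not to 0.\<close>

lemma rank_pos: "r \<ge> 1"
proof (rule ccontr)
  assume "\<not> r \<ge> 1"
  then have "r = 0" by simp
  obtain p where p: "is_min_poly mul e 0 p" using ex_min_poly by blast
  then have "degree p = 0" using min_poly_degree_le \<open>r = 0\<close> by fastforce
  then have "ev p 0 = e" using p by (simp add: jeval_def is_min_poly_def)
  then show False using p e_nonzero by (simp add: is_min_poly_def)
qed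

lemma rpf_a: "j \<in> {1..r} \<Longrightarrow> real_polynomial_function (a j)"
  using gen unfolding generic_min_poly_def by blast

text \<open>The density principle behind every identity below: it may be checked where the powers
  below the rank are independent and coefficients can be compared.\<close>

lemma regular_zero:
  assumes "real_polynomial_function f" "\<And>x. indep_upto r (pw x) \<Longrightarrow> f x = 0"
  shows "f x = 0"
proof -
  obtain u where "indep_upto r (pw u)" using ex_regular by blast
  then obtain q where "real_polynomial_function q" "q u \<noteq> 0" "\<forall>x. q x \<noteq> 0 \<longrightarrow> indep_upto r (pw x)"
    using indep_upto_generic[of "\<lambda>i x. pw x i" r u] polynomial_function_pw by blast
  then show ?thesis using real_polynomial_function_zero_dense assms by blast
qed

definition char_poly :: "'a \<Rightarrow> real poly" where
  "char_poly x = monom 1 r + (\<Sum>j=1..r. monom ((-1) ^ j * a j x) (r - j))"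

lemma ev_char_poly:
  "ev (char_poly x) y = pw y r + (\<Sum>j=1..r. ((-1) ^ j * a j x) *\<^sub>R pw y (r - j))"
  by (simp add: char_poly_def ev_add ev_monom ev_sum)

lemma cayley_hamilton: "pw x r + (\<Sum>j=1..r. ((-1) ^ j * a j x) *\<^sub>R pw x (r - j)) = 0"
proof (rule euclidean_eqI)
  fix b :: 'a assume "b \<in> Basis"
  have "(pw x r + (\<Sum>j=1..r. ((-1) ^ j * a j x) *\<^sub>R pw x (r - j))) \<bullet> b = 0"
  proof (rule regular_zero[where f="\<lambda>x. (pw x r + (\<Sum>j=1..r. ((-1) ^ j * a j x) *\<^sub>R pw x (r - j))) \<bullet> b"])
    have "polynomial_function (\<lambda>x. pw x r + (\<Sum>j=1..r. ((-1) ^ j * a j x) *\<^sub>R pw x (r - j)))"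
      using rpf_a
      by (intro polynomial_function_add polynomial_function_sum polynomial_function_mult polynomial_function_pw)
        (auto simp flip: real_polynomial_function_eq)
    then show "real_polynomial_function (\<lambda>x. (pw x r + (\<Sum>j=1..r. ((-1) ^ j * a j x) *\<^sub>R pw x (r - j))) \<bullet> b)"
      by (simp add: real_polynomial_function_eq polynomial_function_inner)
  next
    fix x assume x: "indep_upto r (pw x)"
    obtain p where p: "is_min_poly mul e x p" using ex_min_poly by blast
    then have "degree p = r"
      using x min_poly_degree_le[OF p] unfolding indep_iff_no_annihilator is_min_poly_def by force
    then have "p = char_poly x" using gen p unfolding generic_min_poly_def char_poly_def by blast
    then have "ev (char_poly x) x = 0" using p by (simp add: is_min_poly_def)
    then show "(pw x r + (\<Sum>j=1..r. ((-1) ^ j * a j x) *\<^sub>R pw x (r - j))) \<bullet> b = 0"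
      by (simp add: ev_char_poly)
  qed
  then show "(pw x r + (\<Sum>j=1..r. ((-1) ^ j * a j x) *\<^sub>R pw x (r - j))) \<bullet> b = 0 \<bullet> b" by simp
qed

text \<open>The constant coefficient of \<open>char_poly x\<close> is \<open>(-1) ^ r\<close> times
  the determinant. Splitting it off, Cayley-Hamilton writes a nonzero multiple of \<open>e\<close>
  as \<open>x\<close> times a polynomial in \<open>x\<close>.\<close>

lemma invertibleI:
  assumes "jdet mul e a x \<noteq> 0"
  shows "x \<in> jinvertibles mul e"
proof -
  obtain c p where cp: "char_poly x = pCons c p" by (cases "char_poly x")
  have "c = coeff (char_poly x) 0" by (simp add: cp)
  also have "\<dots> = (\<Sum>j=1..r. if r - j = 0 then (-1) ^ j * a j x else 0)"
    using rank_pos by (simp add: char_poly_def coeff_sum)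
  also have "\<dots> = (\<Sum>j=1..r. if j = r then (-1) ^ j * a j x else 0)"
    by (intro sum.cong) auto
  also have "\<dots> = (-1) ^ r * a r x" using rank_pos by simp
  finally have c: "c \<noteq> 0" using assms by (simp add: jdet_def)
  have "ev (char_poly x) x = 0" using cayley_hamilton by (simp add: ev_char_poly)
  then have "mul x (ev p x) = - c *\<^sub>R e" by (simp add: cp ev_pCons eq_neg_iff_add_eq_0 add.commute)
  then have "mul x (ev (smult (- inverse c) p) x) = e"
    using c unfolding ev_smult scaleR_right by simp
  then show ?thesis unfolding jinvertibles_def by blast
qed

text \<open>Comparison of coefficients, indexed as in the characteristic polynomial, where
  \<open>a j\<close> belongs to the power \<open>r - j\<close>.\<close>

lemma indep_rev:
  assumes "indep_upto r (pw x)" "(\<Sum>j=1..r. d j *\<^sub>R pw x (r - j)) = 0" "j \<in> {1..r}"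
  shows "d j = 0"
proof -
  have "(\<Sum>i<r. d (r - i) *\<^sub>R pw x i) = (\<Sum>j=1..r. d j *\<^sub>R pw x (r - j))"
    by (rule sum.reindex_bij_witness[of _ "\<lambda>j. r - j" "\<lambda>i. r - i"]) auto
  then have "\<forall>i<r. d (r - i) = 0"
    using assms(1,2) by (auto simp: indep_upto_def)
  then show ?thesis using assms(3) by (metis atLeastAtMost_iff diff_diff_cancel diff_less less_le_trans zero_less_one)
qed

section \<open>Homogeneity and derivatives of the coefficients\<close>

lemma pw_scale: "pw (t *\<^sub>R x) k = t ^ k *\<^sub>R pw x k"
  by (induction k) (auto simp: scaleR_left scaleR_right)

text \<open>Subtracting \<open>t ^ r\<close> times the identity at \<open>x\<close> from the
  identity at \<open>t x\<close> cancels the leading powers; what remains relates lower powers of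
  \<open>x\<close>. Nonzero \<open>t\<close> allows division by \<open>t ^ (r - j)\<close>.\<close>

lemma homogeneous:
  assumes "j \<in> {1..r}" "t \<noteq> 0"
  shows "a j (t *\<^sub>R x) = t ^ j * a j x"
proof -
  have rp: "real_polynomial_function (\<lambda>x. a j (t *\<^sub>R x) - t ^ j * a j x)"
    using real_polynomial_function_compose[OF polynomial_function_cmul[OF polynomial_function_id] rpf_a[OF assms(1)], of t]
    by (intro real_polynomial_function_diff real_polynomial_function.intros(2,4) rpf_a assms) (simp add: o_def)
  have "a j (t *\<^sub>R x) - t ^ j * a j x = 0"
  proof (rule regular_zero[where f="\<lambda>x. a j (t *\<^sub>R x) - t ^ j * a j x", OF rp])
    fix x assume x: "indep_upto r (pw x)"
    have "(\<Sum>j=1..r. ((-1) ^ j * (a j (t *\<^sub>R x) * t ^ (r - j) - t ^ r * a j x)) *\<^sub>R pw x (r - j))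
      = (pw (t *\<^sub>R x) r + (\<Sum>j=1..r. ((-1) ^ j * a j (t *\<^sub>R x)) *\<^sub>R pw (t *\<^sub>R x) (r - j)))
        - t ^ r *\<^sub>R (pw x r + (\<Sum>j=1..r. ((-1) ^ j * a j x) *\<^sub>R pw x (r - j)))"
      by (simp add: pw_scale scaleR_add_right scaleR_sum_right sum_subtractf algebra_simps)
    also have "\<dots> = 0" by (simp only: cayley_hamilton) simp
    finally have "(-1) ^ j * (a j (t *\<^sub>R x) * t ^ (r - j) - t ^ r * a j x) = 0"
      by (rule indep_rev[OF x _ assms(1)])
    moreover have "t ^ r = t ^ (r - j) * t ^ j" using assms(1) by (simp flip: power_add)
    ultimately have "t ^ (r - j) * (a j (t *\<^sub>R x) - t ^ j * a j x) = 0" by (simp add: algebra_simps)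
    then show "a j (t *\<^sub>R x) - t ^ j * a j x = 0" using assms(2) by simp
  qed
  then show ?thesis by simp
qed

lemma has_derivative_a:
  "j \<in> {1..r} \<Longrightarrow> (a j has_derivative frechet_derivative (a j) (at x)) (at x)"
  using differentiable_at_real_polynomial_function[OF rpf_a] by (simp add: frechet_derivative_works)

lemma has_derivative_a_line:
  assumes "j \<in> {1..r}"
  shows "((\<lambda>t. a j (x + t *\<^sub>R h)) has_real_derivative frechet_derivative (a j) (at x) h) (at 0)"
proof -
  have 1: "((\<lambda>t. x + t *\<^sub>R h) has_derivative (\<lambda>t. t *\<^sub>R h)) (at 0)"
    by (auto intro!: derivative_eq_intros)
  interpret L: bounded_linear "frechet_derivative (a j) (at x)"
    using has_derivative_a[OF assms] by (rule has_derivative_bounded_linear)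
  have "(a j has_derivative frechet_derivative (a j) (at x)) (at (x + 0 *\<^sub>R h))"
    using has_derivative_a[OF assms] by simp
  from has_derivative_compose[OF 1 this] show ?thesis
    by (simp add: has_field_derivative_def L.scaleR mult_commute_abs)
qed

text \<open>A polynomial that is homogeneous of degree one equals its derivative at 0, and a
  derivative is linear.\<close>

lemma linear_trace: "linear (a 1)"
proof -
  have 1: "(1::nat) \<in> {1..r}" using rank_pos by simp
  have eq: "a 1 = frechet_derivative (a 1) (at 0)"
  proof
    fix x
    have "a 1 (0 + t *\<^sub>R x) = t * a 1 x" for t
    proof -
      obtain p where p: "\<And>t. a 1 (0 + t *\<^sub>R x) = poly p t"
        using real_polynomial_function_on_line[OF rpf_a[OF 1]] by blast
      \<comment> \<open>Homogeneity is available only for nonzero \<open>t\<close>; infinitely many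
        roots extend it to \<open>t = 0\<close>, the point where the derivative is taken.\<close>
      have "poly (p - [:0, a 1 x:]) t = 0" if "t \<noteq> 0" for t
        using p[of t] homogeneous[OF 1 that, of x] by simp
      then have "UNIV - {0} \<subseteq> {t. poly (p - [:0, a 1 x:]) t = 0}" by blast
      moreover have "infinite (UNIV - {0::real})" by (simp add: infinite_UNIV_char_0)
      ultimately have "p - [:0, a 1 x:] = 0"
        using poly_roots_finite[of "p - [:0, a 1 x:]"] finite_subset by blast
      then have "p = [:0, a 1 x:]" by simp
      then show ?thesis using p by simp
    qed
    then have "((\<lambda>t. t * a 1 x) has_real_derivative frechet_derivative (a 1) (at 0) x) (at 0)"
      using has_derivative_a_line[OF 1, of 0 x] by simp
    moreover have "((\<lambda>t. t * a 1 x) has_real_derivative a 1 x) (at 0)"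
      by (auto intro!: derivative_eq_intros)
    ultimately have "frechet_derivative (a 1) (at 0) x = a 1 x" by (rule DERIV_unique)
    then show "a 1 x = frechet_derivative (a 1) (at 0) x" ..
  qed
  show ?thesis
    by (subst eq) (rule has_derivative_linear[OF has_derivative_a[OF 1]])
qed

lemma trace_derivative: "frechet_derivative (a 1) (at x) h = a 1 h"
  using frechet_derivative_at[OF linear_imp_has_derivative[OF linear_trace], of x] by simp

text \<open>The derivative of the power at \<open>x\<close> in direction \<open>h\<close>, following
  the product rule through the recursion of \<open>jpow\<close>.\<close>

primrec dpw :: "'a \<Rightarrow> 'a \<Rightarrow> nat \<Rightarrow> 'a" where
  "dpw x h 0 = 0"
| "dpw x h (Suc k) = mul h (pw x k) + mul x (dpw x h k)"

lemma has_vector_derivative_pw: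
  "((\<lambda>t. pw (x + t *\<^sub>R h) k) has_vector_derivative dpw x h k) (at 0)"
proof (induction k)
  case (Suc k)
  have "((\<lambda>t. x + t *\<^sub>R h) has_vector_derivative h) (at 0)"
    by (auto intro!: derivative_eq_intros)
  from has_vector_derivative[OF this Suc] show ?case by (simp add: add.commute)
qed simp

lemma cayley_hamilton_derivative:
  "dpw x h r + (\<Sum>j=1..r. ((-1) ^ j * frechet_derivative (a j) (at x) h) *\<^sub>R pw x (r - j)
     + ((-1) ^ j * a j x) *\<^sub>R dpw x h (r - j)) = 0"
proof -
  have summand: "((\<lambda>t. ((-1) ^ j * a j (x + t *\<^sub>R h)) *\<^sub>R pw (x + t *\<^sub>R h) (r - j)) has_vector_derivative
      ((-1) ^ j * frechet_derivative (a j) (at x) h) *\<^sub>R pw x (r - j)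
     + ((-1) ^ j * a j x) *\<^sub>R dpw x h (r - j)) (at 0)" if "j \<in> {1..r}" for j
    using has_vector_derivative_scaleR[OF DERIV_cmult[OF has_derivative_a_line[OF that, of x h], of "(-1)^j"]
       has_vector_derivative_pw[of x h "r - j"]] by (simp add: add.commute)
  have "((\<lambda>t. pw (x + t *\<^sub>R h) r + (\<Sum>j=1..r. ((-1) ^ j * a j (x + t *\<^sub>R h)) *\<^sub>R pw (x + t *\<^sub>R h) (r - j)))
     has_vector_derivative dpw x h r + (\<Sum>j=1..r. ((-1) ^ j * frechet_derivative (a j) (at x) h) *\<^sub>R pw x (r - j)
     + ((-1) ^ j * a j x) *\<^sub>R dpw x h (r - j))) (at 0)"
    by (intro has_vector_derivative_add has_vector_derivative_pw has_vector_derivative_sum summand)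
  from vector_derivative_unique_at[OF this[unfolded cayley_hamilton] has_vector_derivative_const]
  show ?thesis .
qed

lemma dpw_unit: "dpw x e k = real k *\<^sub>R pw x (k - 1)"
proof (induction k)
  case (Suc k)
  show ?case
  proof (cases k)
    case (Suc k')
    then show ?thesis using Suc.IH by (simp add: add_right scaleR_right scaleR_add_left scaleR_2 add_ac)
  qed (simp add: zero_right)
qed simp

text \<open>Supplies the leading coefficient 1 at index 0, where \<open>generic_min_poly\<close>
  says nothing about \<open>a\<close>.\<close>

definition char_coeff :: "nat \<Rightarrow> 'a \<Rightarrow> real" where
  "char_coeff j x = (if j = 0 then 1 else a j x)"

text \<open>Infinitesimal form of the translation rule that the characteristic polynomial of
  \<open>x + t e\<close> at \<open>\<lambda>\<close> is that of \<open>x\<close> at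
  \<open>\<lambda> - t\<close>. It follows by comparing coefficients in the Cayley-Hamilton identity
  differentiated along \<open>e\<close>.\<close>

lemma derivative_unit:
  assumes "j \<in> {1..r}"
  shows "frechet_derivative (a j) (at x) e = real (r - j + 1) * char_coeff (j - 1) x"
proof -
  have rl: "real_polynomial_function (char_coeff (j - 1))"
  proof (cases "j = 1")
    case False
    then have "j - 1 \<in> {1..r}" using assms by auto
    then show ?thesis using rpf_a[of "j - 1"] assms False unfolding char_coeff_def by auto
  qed (simp add: char_coeff_def[abs_def] real_polynomial_function.intros(2))
  have "frechet_derivative (a j) (at x) e - real (r - j + 1) * char_coeff (j - 1) x = 0"
  proof (rule regular_zero[where f="\<lambda>x. frechet_derivative (a j) (at x) e - real (r - j + 1) * char_coeff (j - 1) x"])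
    show "real_polynomial_function (\<lambda>x. frechet_derivative (a j) (at x) e - real (r - j + 1) * char_coeff (j - 1) x)"
      by (intro real_polynomial_function_diff real_polynomial_function.intros(2,4)
          real_polynomial_function_derivative rpf_a assms rl)
    fix x assume x: "indep_upto r (pw x)"
    let ?h = "\<lambda>j. ((-1) ^ j * real (r - j) * char_coeff j x) *\<^sub>R pw x (r - j - 1)"
    have "dpw x e r + (\<Sum>j=1..r. ((-1) ^ j * a j x) *\<^sub>R dpw x e (r - j)) = ?h 0 + (\<Sum>j=1..r. ?h j)"
      by (simp add: dpw_unit char_coeff_def mult_ac)
    also have "\<dots> = (\<Sum>j=0..r. ?h j)" by (simp add: sum.atLeast_Suc_atMost)
    \<comment> \<open>The last summand carries the factor \<open>real (r - r) = 0\<close>; without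
      it the index can be shifted so that \<open>pw x (r - j)\<close> appears.\<close>
    also have "\<dots> = (\<Sum>j=0..<r. ?h j)" using rank_pos by (simp add: sum.last_plus)
    also have "\<dots> = (\<Sum>j=1..r. ?h (j - 1))"
      by (rule sum.reindex_bij_witness[of _ "\<lambda>j. j - 1" Suc]) auto
    also have "\<dots> = (\<Sum>j=1..r. - (((-1) ^ j * real (r - j + 1) * char_coeff (j - 1) x) *\<^sub>R pw x (r - j)))"
    proof (rule sum.cong[OF refl])
      fix j assume j: "j \<in> {1..r}"
      then obtain i where i: "j = Suc i" by (cases j) auto
      show "?h (j - 1) = - (((-1) ^ j * real (r - j + 1) * char_coeff (j - 1) x) *\<^sub>R pw x (r - j))"
        using j by (simp add: i Suc_diff_Suc)
    qed
    finally have eq: "dpw x e r + (\<Sum>j=1..r. ((-1) ^ j * a j x) *\<^sub>R dpw x e (r - j)) = \<dots>" .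
    have "(\<Sum>j=1..r. ((-1) ^ j * (frechet_derivative (a j) (at x) e - real (r - j + 1) * char_coeff (j - 1) x)) *\<^sub>R pw x (r - j))
      = (\<Sum>j=1..r. ((-1) ^ j * frechet_derivative (a j) (at x) e) *\<^sub>R pw x (r - j)) +
        (\<Sum>j=1..r. - (((-1) ^ j * real (r - j + 1) * char_coeff (j - 1) x) *\<^sub>R pw x (r - j)))"
      by (simp add: right_diff_distrib scaleR_diff_left sum_subtractf sum_negf mult.assoc)
    also have "\<dots> = 0"
      using cayley_hamilton_derivative[of x e] unfolding eq[symmetric] by (simp add: sum.distrib add_ac)
    finally have "(-1) ^ j * (frechet_derivative (a j) (at x) e - real (r - j + 1) * char_coeff (j - 1) x) = 0"
      by (rule indep_rev[OF x _ assms])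
    then show "frechet_derivative (a j) (at x) e - real (r - j + 1) * char_coeff (j - 1) x = 0" by simp
  qed
  then show ?thesis by simp
qed

text \<open>Euler's relation for a homogeneous function, taken at \<open>e\<close> in direction
  \<open>e\<close>. The radius 1 keeps \<open>1 + t\<close> away from 0.\<close>

lemma euler_unit:
  assumes "j \<in> {1..r}"
  shows "frechet_derivative (a j) (at e) e = real j * a j e"
proof -
  have "((\<lambda>t. a j (e + t *\<^sub>R e)) has_real_derivative real j * a j e) (at 0)"
  proof (rule has_field_derivative_transform_within[where d=1])
    show "((\<lambda>t. (1 + t) ^ j * a j e) has_real_derivative real j * a j e) (at 0)"
      by (auto intro!: derivative_eq_intros)
    fix t :: real assume "dist t 0 < 1"
    then have "1 + t \<noteq> 0" by auto
    then show "(1 + t) ^ j * a j e = a j (e + t *\<^sub>R e)"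
      using homogeneous[OF assms, of "1 + t" e] by (simp add: scaleR_add_left)
  qed auto
  with has_derivative_a_line[OF assms, of e e] show ?thesis by (rule DERIV_unique)
qed

text \<open>Equating the two values of the derivative along \<open>e\<close> at \<open>e\<close>
  gives the recursion of the binomial coefficients \<open>r\<close> choose \<open>j\<close>, which
  preserves positivity.\<close>

lemma char_coeff_unit_pos: "j \<le> r \<Longrightarrow> char_coeff j e > 0"
proof (induction j)
  case (Suc j)
  then have "Suc j \<in> {1..r}" by simp
  from derivative_unit[OF this, of e] euler_unit[OF this]
  have "real (Suc j) * a (Suc j) e = real (r - Suc j + 1) * char_coeff j e" by simp
  moreover have "\<dots> > 0" using Suc by simp
  ultimately have "a (Suc j) e > 0" by (metis zero_less_mult_pos of_nat_0_less_iff zero_less_Suc)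
  then show ?case by (simp add: char_coeff_def)
qed (simp add: char_coeff_def)

lemma det_unit_pos: "jdet mul e a e > 0"
  using char_coeff_unit_pos[of r] rank_pos by (simp add: char_coeff_def jdet_def)

lemma trace_unit_pos: "a 1 e > 0"
  using char_coeff_unit_pos[of 1] rank_pos by (simp add: char_coeff_def)

section \<open>Associativity and nondegeneracy of the trace form\<close>

lemma jordan_linearized:
  "mul x (mul (mul y z) w) + mul y (mul (mul z x) w) + mul z (mul (mul x y) w)
   = mul (mul y z) (mul x w) + mul (mul z x) (mul y w) + mul (mul x y) (mul z w)"
proof (rule vector_eq_rdot[THEN iffD1], rule allI)
  fix c
  note J = arg_cong[OF jordan_id, where f="\<lambda>v. v \<bullet> c"]
  show "(mul x (mul (mul y z) w) + mul y (mul (mul z x) w) + mul z (mul (mul x y) w)) \<bullet> c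
   = (mul (mul y z) (mul x w) + mul (mul z x) (mul y w) + mul (mul x y) (mul z w)) \<bullet> c"
    \<comment> \<open>Polarization of an identity that is cubic in its first variable:
      inclusion-exclusion over the sums of \<open>x\<close>, \<open>y\<close>, \<open>z\<close>
      isolates the part linear in each. Pairing with \<open>c\<close> makes it real linear
      arithmetic.\<close>
    using J[of "x + y + z" w] J[of "x + y" w] J[of "x + z" w] J[of "y + z" w] J[of x w] J[of y w] J[of z w]
    unfolding add_left add_right inner_add_left comm[of y x] comm[of z x] comm[of z y]
    by linarith
qed

text \<open>\<open>D\<close> is the commutator of multiplication by \<open>w\<close> and by
  \<open>x\<close>. The two instances of the linearized identity that exchange \<open>x\<close> and
  \<open>w\<close> have the same right-hand side; their difference is the Leibniz rule.\<close>

lemma inner_derivation: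
  fixes x w
  defines "D \<equiv> \<lambda>y. mul w (mul x y) - mul x (mul w y)"
  shows "D (mul y z) = mul (D y) z + mul y (D z)"
proof -
  have 1: "mul x (mul w (mul y z)) + mul y (mul w (mul x z)) + mul (mul w (mul x y)) z
    = mul (mul y z) (mul x w) + mul (mul x z) (mul y w) + mul (mul x y) (mul z w)"
    using jordan_linearized[of x y z w] by (simp add: comm[of z x] comm[of _ w] comm[of z "mul w (mul x y)"])
  have 2: "mul w (mul x (mul y z)) + mul y (mul x (mul w z)) + mul (mul x (mul w y)) z
    = mul (mul y z) (mul x w) + mul (mul x z) (mul y w) + mul (mul x y) (mul z w)"
    using jordan_linearized[of w y z x]
    by (simp add: comm[of z w] comm[of _ x] comm[of z "mul x (mul w y)"] comm[of y w] comm[of "mul w z"] comm[of "mul w y" "mul x z"] add_ac)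
  show ?thesis
    using 1 2 unfolding D_def by (simp add: diff_left diff_right algebra_simps)
qed

text \<open>Differentiating the Cayley-Hamilton identity along an inner derivation \<open>D\<close> and subtracting
  \<open>D\<close> applied to the identity leaves a relation between lower powers of a regular element; it yields
  \<open>tr \<circ> D = 0\<close> without exponentiating \<open>D\<close> to automorphisms.\<close>

lemma trace_assoc: "a 1 (mul w (mul x y)) = a 1 (mul x (mul w y))"
proof -
  define D where "D y = mul w (mul x y) - mul x (mul w y)" for y
  have der: "D (mul y z) = mul (D y) z + mul y (D z)" for y z
    unfolding D_def by (rule inner_derivation)
  have lin: "linear D"
    unfolding D_def by (rule linearI) (simp_all add: add_right scaleR_right scaleR_diff_right)
  interpret D: linear D by fact
  have De: "D e = 0" using der[of e e] by simp
  \<comment> \<open>\<open>D\<close> kills \<open>e\<close> and obeys the same product rule as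
    \<open>dpw\<close>, so differentiating a power along \<open>D y\<close> amounts to applying
    \<open>D\<close> to it.\<close>
  have dpw: "dpw y (D y) k = D (pw y k)" for y k
    by (induction k) (auto simp: De der)
  have rp: "real_polynomial_function (\<lambda>y. a 1 (D y))"
    using linear_compose[OF lin linear_trace] by (auto simp: o_def linear_conv_bounded_linear)
  have "a 1 (D y) = 0"
  proof (rule regular_zero[where f="\<lambda>y. a 1 (D y)", OF rp])
    fix y assume y: "indep_upto r (pw y)"
    have "(\<Sum>j=1..r. ((-1) ^ j * frechet_derivative (a j) (at y) (D y)) *\<^sub>R pw y (r - j))
        + D (pw y r + (\<Sum>j=1..r. ((-1) ^ j * a j y) *\<^sub>R pw y (r - j))) = 0"
      using cayley_hamilton_derivative[of y "D y"]
      by (simp add: dpw D.add D.sum D.scale sum.distrib algebra_simps)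
    then have "(\<Sum>j=1..r. ((-1) ^ j * frechet_derivative (a j) (at y) (D y)) *\<^sub>R pw y (r - j)) = 0"
      by (simp only: cayley_hamilton D.zero add_0_right)
    \<comment> \<open>At \<open>j = 1\<close> the derivative is that of the linear trace, so the
      vanishing coefficient is minus \<open>a 1 (D y)\<close>.\<close>
    from indep_rev[OF y this, of 1] rank_pos show "a 1 (D y) = 0"
      by (simp add: trace_derivative del: One_nat_def)
  qed
  then show ?thesis unfolding D_def using linear_diff[OF linear_trace] by simp
qed

lemma tau_bilinear: "bilinear (jtau mul a)"
  unfolding jtau_def bilinear_def
  by (auto intro!: linearI simp: add_left add_right scaleR_left scaleR_right
      linear_add[OF linear_trace] linear_scale[OF linear_trace] simp del: One_nat_def)

text \<open>By associativity of the form its radical is an ideal. It misses \<open>e\<close>, which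
  has positive trace, so simplicity forces it to be zero.\<close>

lemma tau_nondegenerate:
  assumes "\<And>y. jtau mul a y x = 0"
  shows "x = 0"
proof -
  let ?R = "{x. \<forall>y. jtau mul a y x = 0}"
  have "subspace ?R"
    unfolding subspace_def using tau_bilinear by (auto simp: bilinear_radd bilinear_rmul bilinear_rzero)
  moreover have "mul z x \<in> ?R" if "x \<in> ?R" for z x
  proof -
    have "jtau mul a y (mul z x) = jtau mul a (mul y z) x" for y
      using trace_assoc[of y x z] by (simp add: jtau_def comm[of z x] comm[of "mul y z" x])
    then show ?thesis using that by simp
  qed
  ultimately have "?R = {0} \<or> ?R = UNIV" by (rule ideal_trivial)
  moreover have "e \<notin> ?R" using trace_unit_pos by (auto simp: jtau_def intro!: exI[of _ e])
  ultimately show ?thesis using assms by blast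
qed

text \<open>Guarantees that the exponentials in \<open>is_det_diff_op\<close> exhaust the
  exponentials of real linear forms. \<open>T\<close> is the Gram map of the form with respect to
  the auxiliary inner product: injective by nondegeneracy, hence onto.\<close>

lemma tau_represents:
  fixes \<eta> :: "'a \<Rightarrow> real"
  assumes "linear \<eta>"
  shows "\<exists>x. \<forall>y. \<eta> y = jtau mul a y x"
proof -
  define T where "T x = (\<Sum>b\<in>Basis. jtau mul a b x *\<^sub>R b)" for x
  have lin: "linear (\<lambda>y. jtau mul a y x)" "linear (jtau mul a y)" for x y
    using tau_bilinear by (auto simp: bilinear_def)
  have T: "jtau mul a y x = y \<bullet> T x" for x y
  proof -
    have "jtau mul a y x = jtau mul a (\<Sum>b\<in>Basis. (y \<bullet> b) *\<^sub>R b) x" by (simp add: euclidean_representation)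
    also have "\<dots> = (\<Sum>b\<in>Basis. (y \<bullet> b) * jtau mul a b x)"
      by (simp add: linear_sum[OF lin(1)] linear_scale[OF lin(1)])
    finally show ?thesis by (simp add: T_def inner_sum_right mult.commute)
  qed
  have linT: "linear T"
    by (rule linearI) (simp_all add: T_def linear_add[OF lin(2)] linear_scale[OF lin(2)]
        scaleR_add_left sum.distrib scaleR_sum_right)
  have "inj T"
    using tau_nondegenerate T by (subst linear_injective_0[OF linT]) auto
  then have "surj T" using linT linear_injective_imp_surjective by blast
  then obtain x where x: "T x = (\<Sum>b\<in>Basis. \<eta> b *\<^sub>R b)" by (metis surjD)
  have "\<eta> y = jtau mul a y x" for y
  proof -
    have "\<eta> y = \<eta> (\<Sum>b\<in>Basis. (y \<bullet> b) *\<^sub>R b)" by (simp add: euclidean_representation)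
    also have "\<dots> = (\<Sum>b\<in>Basis. (y \<bullet> b) * \<eta> b)"
      by (simp add: linear_sum[OF assms] linear_scale[OF assms])
    also have "\<dots> = y \<bullet> T x" by (simp add: x inner_sum_right mult.commute)
    finally show ?thesis by (simp add: T)
  qed
  then show ?thesis by blast
qed

end

section \<open>Polynomial differential operators and plane waves\<close>

lemma complex_polynomial_function_iff:
  fixes p :: "'v::euclidean_space \<Rightarrow> complex"
  shows "polynomial_function p \<longleftrightarrow>
    real_polynomial_function (\<lambda>x. Re (p x)) \<and> real_polynomial_function (\<lambda>x. Im (p x))"
  by (subst polynomial_function_iff_Basis_inner) (auto simp: Basis_complex_def)

lemma complex_polynomial_function_mult:
  fixes p q :: "'v::euclidean_space \<Rightarrow> complex"
  assumes "polynomial_function p" "polynomial_function q"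
  shows "polynomial_function (\<lambda>x. p x * q x)"
  using assms unfolding complex_polynomial_function_iff
  by (auto intro!: real_polynomial_function_diff real_polynomial_function.intros(3,4))

lemma polynomial_function_dir_deriv:
  fixes p :: "'v::euclidean_space \<Rightarrow> complex"
  assumes "polynomial_function p"
  shows "polynomial_function (dir_deriv v p)"
proof -
  have "(p has_derivative frechet_derivative p (at z)) (at z)" for z
    using differentiable_at_polynomial_function[OF assms] by (simp add: frechet_derivative_works)
  then have "frechet_derivative (\<lambda>x. Re (p x)) (at z) = (\<lambda>v. Re (frechet_derivative p (at z) v))"
    "frechet_derivative (\<lambda>x. Im (p x)) (at z) = (\<lambda>v. Im (frechet_derivative p (at z) v))" for z
    by (auto intro!: frechet_derivative_at[symmetric] has_derivative_Re has_derivative_Im)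
  then show ?thesis
    using assms real_polynomial_function_derivative[of "\<lambda>x. Re (p x)" v]
      real_polynomial_function_derivative[of "\<lambda>x. Im (p x)" v]
    by (simp add: complex_polynomial_function_iff dir_deriv_def)
qed

lemma polynomial_function_smooth:
  fixes p :: "'v::euclidean_space \<Rightarrow> complex"
  assumes "polynomial_function p" "open U"
  shows "smooth_at_all U p"
  by (rule smooth_alg[where A="{p. polynomial_function p}", OF assms(2)])
    (use assms polynomial_function_dir_deriv in
      \<open>auto intro: alg.gen differentiable_at_polynomial_function\<close>)

text \<open>A line from \<open>u\<close> to any point stays in \<open>U\<close> for small
  parameters, so the restricted difference has infinitely many roots.\<close>

lemma complex_polynomial_function_eq_on_open:
  fixes p q :: "'v::euclidean_space \<Rightarrow> complex"
  assumes "polynomial_function p" "polynomial_function q" "open U" "u \<in> U"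
    and eq: "\<And>w. w \<in> U \<Longrightarrow> p w = q w"
  shows "p = q"
proof
  fix w
  have zero: "f w = 0" if f: "real_polynomial_function f" "\<And>w. w \<in> U \<Longrightarrow> f w = 0" for f :: "'v \<Rightarrow> real"
  proof -
    obtain s where s: "\<And>t. f (u + t *\<^sub>R (w - u)) = poly s t"
      using real_polynomial_function_on_line[OF f(1)] by blast
    have "((\<lambda>t. u + t *\<^sub>R (w - u)) \<longlongrightarrow> u + 0 *\<^sub>R (w - u)) (at 0)"
      by (intro tendsto_intros)
    then have "\<forall>\<^sub>F t in at 0. u + t *\<^sub>R (w - u) \<in> U"
      using assms(3,4) by (intro topological_tendstoD) auto
    then obtain d where d: "d > 0" "\<And>t. t \<noteq> 0 \<Longrightarrow> dist t 0 < d \<Longrightarrow> u + t *\<^sub>R (w - u) \<in> U"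
      by (auto simp: eventually_at)
    have "{0<..<d} \<subseteq> {t. poly s t = 0}"
      using d(2) f(2) s by (auto simp flip: s)
    moreover have "infinite {0<..<d}" using d(1) by (simp add: infinite_Ioo)
    ultimately have "s = 0" using poly_roots_finite[of s] finite_subset by blast
    then show ?thesis using s[of 1] by simp
  qed
  have "Re (p w) - Re (q w) = 0"
    using assms eq by (intro zero[of "\<lambda>w. Re (p w) - Re (q w)"] real_polynomial_function_diff)
      (auto simp: complex_polynomial_function_iff)
  moreover have "Im (p w) - Im (q w) = 0"
    using assms eq by (intro zero[of "\<lambda>w. Im (p w) - Im (q w)"] real_polynomial_function_diff)
      (auto simp: complex_polynomial_function_iff)
  ultimately show "p w = q w" by (simp add: complex_eq_iff)
qed

text \<open>Polynomials times a fixed exponential are stable under differentiation. With the wave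
  exponent this makes symbols polynomial; with exponent 0 it keeps polynomials polynomial.\<close>

lemma iter_deriv_poly_exp:
  fixes p \<psi> :: "'v::euclidean_space \<Rightarrow> complex"
  assumes "polynomial_function p" "polynomial_function \<psi>"
  shows "\<exists>p'. polynomial_function p' \<and> iter_deriv vs (\<lambda>w. p w * exp (\<psi> w)) = (\<lambda>w. p' w * exp (\<psi> w))"
proof (induction vs)
  case (Cons v vs)
  then obtain q where q: "polynomial_function q"
    "iter_deriv vs (\<lambda>w. p w * exp (\<psi> w)) = (\<lambda>w. q w * exp (\<psi> w))" by blast
  have sm: "smooth_at_all UNIV \<psi>" "smooth_at_all UNIV q"
    using assms q polynomial_function_smooth by auto
  have "dir_deriv v (\<lambda>w. q w * exp (\<psi> w)) = (\<lambda>w. (q w * dir_deriv v \<psi> w + dir_deriv v q w) * exp (\<psi> w))"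
  proof
    fix w
    show "dir_deriv v (\<lambda>w. q w * exp (\<psi> w)) w = (q w * dir_deriv v \<psi> w + dir_deriv v q w) * exp (\<psi> w)"
      using smooth_at_all_differentiable[OF sm(2)] smooth_at_all_differentiable[OF smooth_at_all_exp(1)[OF _ sm(1)]]
      by (simp add: dir_deriv_mult smooth_at_all_exp(2)[OF _ sm(1)] algebra_simps)
  qed
  moreover have "polynomial_function (\<lambda>w. q w * dir_deriv v \<psi> w + dir_deriv v q w)"
    using q(1) assms(2) by (intro polynomial_function_add complex_polynomial_function_mult polynomial_function_dir_deriv)
  ultimately show ?case using q(2) by auto
qed (use assms in auto)

lemma poly_diff_op_poly_exp:
  fixes p \<psi> :: "'v::euclidean_space \<Rightarrow> complex"
  assumes "poly_diff_op T" "polynomial_function p" "polynomial_function \<psi>"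
  shows "\<exists>p'. polynomial_function p' \<and> T (\<lambda>w. p w * exp (\<psi> w)) = (\<lambda>w. p' w * exp (\<psi> w))"
proof -
  obtain I c where T: "finite I" "\<And>vs. vs \<in> I \<Longrightarrow> polynomial_function (c vs)"
    "\<And>f z. T f z = (\<Sum>vs\<in>I. c vs z * iter_deriv vs f z)"
    using assms(1) unfolding poly_diff_op_def by blast
  obtain p' where p': "\<And>vs. polynomial_function (p' vs)"
    "\<And>vs. iter_deriv vs (\<lambda>w. p w * exp (\<psi> w)) = (\<lambda>w. p' vs w * exp (\<psi> w))"
    using iter_deriv_poly_exp[OF assms(2,3)] by metis
  have "polynomial_function (\<lambda>w. \<Sum>vs\<in>I. c vs w * p' vs w)"
    using T(1,2) p'(1) by (intro polynomial_function_sum complex_polynomial_function_mult)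
  moreover have "T (\<lambda>w. p w * exp (\<psi> w)) = (\<lambda>w. (\<Sum>vs\<in>I. c vs w * p' vs w) * exp (\<psi> w))"
    by (simp add: fun_eq_iff T(3) p'(2) sum_distrib_right mult.assoc)
  ultimately show ?thesis by blast
qed

text \<open>Here \<open>T (k - 1)\<close> acts first and \<open>T 0\<close> last, opposite to the
  order in \<open>F_comp\<close>.\<close>

primrec op_chain :: "(nat \<Rightarrow> ('v \<Rightarrow> complex) \<Rightarrow> 'v \<Rightarrow> complex) \<Rightarrow> nat \<Rightarrow> ('v \<Rightarrow> complex) \<Rightarrow> 'v \<Rightarrow> complex" where
  "op_chain T 0 f = f"
| "op_chain T (Suc k) f = op_chain T k (T k f)"

lemma op_chain_poly_exp:
  fixes p \<psi> :: "'v::euclidean_space \<Rightarrow> complex"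
  assumes "\<And>j. poly_diff_op (T j)" "polynomial_function p" "polynomial_function \<psi>"
  shows "\<exists>p'. polynomial_function p' \<and> op_chain T k (\<lambda>w. p w * exp (\<psi> w)) = (\<lambda>w. p' w * exp (\<psi> w))"
  using assms(2)
proof (induction k arbitrary: p)
  case (Suc k)
  then show ?case using poly_diff_op_poly_exp[OF assms(1)[of k] Suc.prems assms(3)] by auto
qed auto

lemma poly_diff_op_smooth:
  assumes "poly_diff_op T" "open U" "smooth_at_all U f"
  shows "smooth_at_all U (T f)"
proof -
  obtain I c where T: "finite I" "\<And>vs. vs \<in> I \<Longrightarrow> polynomial_function (c vs)"
    "\<And>f z. T f z = (\<Sum>vs\<in>I. c vs z * iter_deriv vs f z)"
    using assms(1) unfolding poly_diff_op_def by blast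
  have "smooth_at_all U (\<lambda>z. \<Sum>vs\<in>I. c vs z * iter_deriv vs f z)"
    using T(1,2) assms(2,3)
    by (intro smooth_at_all_sum smooth_at_all_mult)
      (auto intro: smooth_at_all_iter_deriv polynomial_function_smooth)
  moreover have "T f = (\<lambda>z. \<Sum>vs\<in>I. c vs z * iter_deriv vs f z)" using T(3) by blast
  ultimately show ?thesis by simp
qed

lemma const_diff_op_imp_poly: "const_diff_op T \<Longrightarrow> poly_diff_op T"
proof -
  assume "const_diff_op T"
  then obtain I c where "finite I" "\<forall>vs\<in>I. set vs \<subseteq> Basis"
    "\<forall>f z. T f z = (\<Sum>vs\<in>I. c vs * iter_deriv vs f z)" unfolding const_diff_op_def by blast
  then show "poly_diff_op T" unfolding poly_diff_op_def
    by (intro exI[of _ I] exI[of _ "\<lambda>vs z. c vs"]) auto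
qed

lemma poly_diff_op_cong_open:
  assumes "poly_diff_op T" "open U" "z \<in> U" "\<And>y. y \<in> U \<Longrightarrow> f y = g y"
  shows "T f z = T g z"
proof -
  obtain I c where T: "\<And>f z. T f z = (\<Sum>vs\<in>I. c vs z * iter_deriv vs f z)"
    using assms(1) unfolding poly_diff_op_def by blast
  show ?thesis unfolding T using iter_deriv_cong_open[OF assms(2-4)] by simp
qed

lemma poly_diff_op_funpow_cong_open:
  assumes "poly_diff_op T" "open U" "z \<in> U" "\<And>y. y \<in> U \<Longrightarrow> f y = g y"
  shows "(T ^^ k) f z = (T ^^ k) g z"
  using assms(3)
proof (induction k arbitrary: z)
  case (Suc k)
  show ?case using poly_diff_op_cong_open[OF assms(1,2) Suc.prems Suc.IH] by simp
qed (use assms(4) in simp)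

section \<open>Operators acting in one of two groups of variables\<close>

lemma iter_deriv_fst:
  assumes "smooth_at_all UNIV G"
  shows "iter_deriv vs (\<lambda>z. G (z, w)) z = iter_deriv (map (\<lambda>v. (v, 0)) vs) G (z, w)"
proof (induction vs arbitrary: z)
  case (Cons v vs)
  let ?H = "iter_deriv (map (\<lambda>v. (v, 0)) vs) G"
  have 1: "((\<lambda>z. (z, w)) has_derivative (\<lambda>h. (h, 0))) (at z)"
    by (auto intro!: derivative_eq_intros)
  have "?H differentiable (at (z, w))"
    using smooth_at_all_differentiable[OF smooth_at_all_iter_deriv[OF open_UNIV assms]] by simp
  then have "(?H has_derivative frechet_derivative ?H (at (z, w))) (at (z, w))"
    by (simp add: frechet_derivative_works)
  from has_derivative_dir_deriv[OF has_derivative_compose[OF 1 this], of v]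
  have "dir_deriv v (\<lambda>z. ?H (z, w)) z = dir_deriv (v, 0) ?H (z, w)" by (simp add: dir_deriv_def)
  moreover have "iter_deriv vs (\<lambda>z. G (z, w)) = (\<lambda>z. ?H (z, w))" using Cons.IH by blast
  ultimately show ?case by simp
qed simp

lemma iter_deriv_snd:
  assumes "smooth_at_all UNIV G"
  shows "iter_deriv us (\<lambda>w. G (z, w)) w = iter_deriv (map (\<lambda>v. (0, v)) us) G (z, w)"
proof (induction us arbitrary: w)
  case (Cons v vs)
  let ?H = "iter_deriv (map (\<lambda>v. (0, v)) vs) G"
  have 1: "((\<lambda>w. (z, w)) has_derivative (\<lambda>h. (0, h))) (at w)"
    by (auto intro!: derivative_eq_intros)
  have "?H differentiable (at (z, w))"
    using smooth_at_all_differentiable[OF smooth_at_all_iter_deriv[OF open_UNIV assms]] by simp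
  then have "(?H has_derivative frechet_derivative ?H (at (z, w))) (at (z, w))"
    by (simp add: frechet_derivative_works)
  from has_derivative_dir_deriv[OF has_derivative_compose[OF 1 this], of v]
  have "dir_deriv v (\<lambda>w. ?H (z, w)) w = dir_deriv (0, v) ?H (z, w)" by (simp add: dir_deriv_def)
  moreover have "iter_deriv vs (\<lambda>w. G (z, w)) = (\<lambda>w. ?H (z, w))" using Cons.IH by blast
  ultimately show ?case by simp
qed simp

lemma smooth_at_all_fst:
  assumes "smooth_at_all UNIV G"
  shows "smooth_at_all UNIV (\<lambda>z. G (z, w))"
  unfolding smooth_at_all_def
proof (intro allI impI ballI)
  fix vs z
  let ?H = "iter_deriv (map (\<lambda>v. (v, 0)) vs) G"
  have "?H differentiable (at (z, w))"
    using smooth_at_all_differentiable[OF smooth_at_all_iter_deriv[OF open_UNIV assms]] by simp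
  moreover have "(\<lambda>z. (z, w)) differentiable (at z)"
    by (rule differentiableI[of _ "\<lambda>h. (h, 0)"]) (auto intro!: derivative_eq_intros)
  ultimately have "(\<lambda>z. ?H (z, w)) differentiable (at z)"
    using differentiable_chain_at[of "\<lambda>z. (z, w)" z ?H] by (simp add: o_def)
  moreover have "iter_deriv vs (\<lambda>z. G (z, w)) = (\<lambda>z. ?H (z, w))"
    using iter_deriv_fst[OF assms] by blast
  ultimately show "iter_deriv vs (\<lambda>z. G (z, w)) differentiable (at z)" by simp
qed

lemma smooth_at_all_snd:
  assumes "smooth_at_all UNIV G"
  shows "smooth_at_all UNIV (\<lambda>w. G (z, w))"
  unfolding smooth_at_all_def
proof (intro allI impI ballI)
  fix vs w
  let ?H = "iter_deriv (map (\<lambda>v. (0, v)) vs) G"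
  have "?H differentiable (at (z, w))"
    using smooth_at_all_differentiable[OF smooth_at_all_iter_deriv[OF open_UNIV assms]] by simp
  moreover have "(\<lambda>w. (z, w)) differentiable (at w)"
    by (rule differentiableI[of _ "\<lambda>h. (0, h)"]) (auto intro!: derivative_eq_intros)
  ultimately have "(\<lambda>w. ?H (z, w)) differentiable (at w)"
    using differentiable_chain_at[of "\<lambda>w. (z, w)" w ?H] by (simp add: o_def)
  moreover have "iter_deriv vs (\<lambda>w. G (z, w)) = (\<lambda>w. ?H (z, w))"
    using iter_deriv_snd[OF assms] by blast
  ultimately show "iter_deriv vs (\<lambda>w. G (z, w)) differentiable (at w)" by simp
qed

lemma poly_diff_op_partial_smooth:
  fixes G :: "'v::euclidean_space \<times> 'w::euclidean_space \<Rightarrow> complex"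
  assumes "poly_diff_op T" "smooth_at_all UNIV G"
  shows "smooth_at_all UNIV (\<lambda>(z, w). T (\<lambda>w. G (z, w)) w)"
proof -
  obtain J d where T: "finite J" "\<And>us. us \<in> J \<Longrightarrow> polynomial_function (d us)"
    "\<And>f z. T f z = (\<Sum>us\<in>J. d us z * iter_deriv us f z)"
    using assms(1) unfolding poly_diff_op_def by blast
  have d: "polynomial_function (\<lambda>Z. d us (snd Z :: 'w))" if "us \<in> J" for us
    using polynomial_function_compose[OF polynomial_function_bounded_linear[OF bounded_linear_snd] T(2)[OF that]]
    by (simp add: o_def)
  have "smooth_at_all UNIV (\<lambda>Z. \<Sum>us\<in>J. d us (snd Z) * iter_deriv (map (\<lambda>v. (0, v)) us) G Z)"
    using T(1) assms(2) d
    by (intro smooth_at_all_sum smooth_at_all_mult)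
      (auto intro: smooth_at_all_iter_deriv polynomial_function_smooth)
  then show ?thesis
    by (simp add: T(3) iter_deriv_snd[OF assms(2)] case_prod_unfold)
qed

text \<open>The coefficients of each operator are constant in the variable of the other, and the
  derivatives, viewed in directions \<open>(v, 0)\<close> and \<open>(0, v)\<close> on the product,
  commute by \<open>iter_deriv_mset\<close>.\<close>

lemma poly_diff_op_partial_commute:
  fixes G :: "'v::euclidean_space \<times> 'w::euclidean_space \<Rightarrow> complex"
  assumes "poly_diff_op S" "poly_diff_op T" "smooth_at_all UNIV G"
  shows "S (\<lambda>z. T (\<lambda>w. G (z, w)) w) z = T (\<lambda>w. S (\<lambda>z. G (z, w)) z) w"
proof -
  obtain I c where S: "finite I" "\<And>f z. S f z = (\<Sum>vs\<in>I. c vs z * iter_deriv vs f z)"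
    using assms(1) unfolding poly_diff_op_def by blast
  obtain J d where T: "finite J" "\<And>f z. T f z = (\<Sum>us\<in>J. d us z * iter_deriv us f z)"
    using assms(2) unfolding poly_diff_op_def by blast
  let ?f = "map (\<lambda>v. (v, 0))" and ?s = "map (\<lambda>v. (0, v))"
  have sm: "smooth_at_all UNIV (iter_deriv us G)" for us
    by (rule smooth_at_all_iter_deriv[OF open_UNIV assms(3)])
  have 1: "iter_deriv vs (\<lambda>z. \<Sum>us\<in>J. d us w * iter_deriv (?s us) G (z, w)) z
      = (\<Sum>us\<in>J. d us w * iter_deriv (?f vs @ ?s us) G (z, w))" for vs
    using iter_deriv_sum[OF open_UNIV T(1) smooth_at_all_fst[OF sm], where z=z]
    by (simp add: iter_deriv_fst[OF sm] iter_deriv_append)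
  have 2: "iter_deriv us (\<lambda>w. \<Sum>vs\<in>I. c vs z * iter_deriv (?f vs) G (z, w)) w
      = (\<Sum>vs\<in>I. c vs z * iter_deriv (?s us @ ?f vs) G (z, w))" for us
    using iter_deriv_sum[OF open_UNIV S(1) smooth_at_all_snd[OF sm], where z=w]
    by (simp add: iter_deriv_snd[OF sm] iter_deriv_append)
  have 3: "iter_deriv (?s us @ ?f vs) G (z, w) = iter_deriv (?f vs @ ?s us) G (z, w)" for us vs
    by (rule iter_deriv_mset[OF open_UNIV assms(3)]) (simp_all add: add.commute)
  have "S (\<lambda>z. T (\<lambda>w. G (z, w)) w) z
      = (\<Sum>vs\<in>I. \<Sum>us\<in>J. c vs z * (d us w * iter_deriv (?f vs @ ?s us) G (z, w)))"
    by (simp add: S(2) T(2) iter_deriv_snd[OF assms(3)] 1 sum_distrib_left)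
  also have "\<dots> = (\<Sum>us\<in>J. \<Sum>vs\<in>I. d us w * (c vs z * iter_deriv (?f vs @ ?s us) G (z, w)))"
    by (subst sum.swap) (simp add: mult_ac)
  also have "\<dots> = T (\<lambda>w. S (\<lambda>z. G (z, w)) z) w"
    by (simp add: S(2) T(2) iter_deriv_fst[OF assms(3)] 2 3 sum_distrib_left)
  finally show ?thesis .
qed

lemma op_chain_partial_commute:
  fixes G :: "'v::euclidean_space \<times> 'w::euclidean_space \<Rightarrow> complex"
  assumes "poly_diff_op S" "\<And>j. poly_diff_op (T j)" "smooth_at_all UNIV G"
  shows "S (\<lambda>z. op_chain T k (\<lambda>w. G (z, w)) w) z = op_chain T k (\<lambda>w. S (\<lambda>z. G (z, w)) z) w"
  using assms(3)
proof (induction k arbitrary: G)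
  case (Suc k)
  have "S (\<lambda>z. op_chain T (Suc k) (\<lambda>w. G (z, w)) w) z = op_chain T k (\<lambda>w. S (\<lambda>z. T k (\<lambda>w. G (z, w)) w) z) w"
    using Suc.IH[OF poly_diff_op_partial_smooth[OF assms(2)[of k] Suc.prems]] by simp
  also have "(\<lambda>w. S (\<lambda>z. T k (\<lambda>w. G (z, w)) w) z) = T k (\<lambda>w. S (\<lambda>z. G (z, w)) z)"
    using poly_diff_op_partial_commute[OF assms(1,2) Suc.prems] by blast
  finally show ?case by simp
qed simp

text \<open>The difference of the two sides is a single sum over \<open>I \<times> UNIV\<close>, the
  boolean selecting the side and its sign; \<open>const_coeff_zero\<close> applies to it.\<close>

lemma const_coeff_eq:
  fixes u u' :: "'i \<Rightarrow> 'v::euclidean_space list"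
  assumes "finite I"
    and sym: "\<And>\<eta>. linear \<eta> \<Longrightarrow> (\<Sum>i\<in>I. c i * (\<Prod>v\<leftarrow>u i. complex_of_real (\<eta> v)))
        = (\<Sum>i\<in>I. c i * (\<Prod>v\<leftarrow>u' i. complex_of_real (\<eta> v)))"
    and U: "open U" "smooth_at_all U f" "z \<in> U"
  shows "(\<Sum>i\<in>I. c i * iter_deriv (u i) f z) = (\<Sum>i\<in>I. c i * iter_deriv (u' i) f z)"
proof -
  let ?c = "\<lambda>(i, b). if b then c i else - c i" and ?u = "\<lambda>(i, b). if b then u i else u' i"
  have split: "(\<Sum>j\<in>I \<times> UNIV. ?c j * h (?u j)) = (\<Sum>i\<in>I. c i * h (u i)) - (\<Sum>i\<in>I. c i * h (u' i))"
    for h :: "'v list \<Rightarrow> complex"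
  proof -
    have "(\<Sum>j\<in>I \<times> UNIV. ?c j * h (?u j)) = (\<Sum>i\<in>I. \<Sum>b\<in>UNIV. ?c (i, b) * h (?u (i, b)))"
      by (subst sum.cartesian_product) (rule sum.cong, auto)
    then show ?thesis by (simp add: UNIV_bool sum_subtractf)
  qed
  have "(\<Sum>j\<in>I \<times> UNIV. ?c j * iter_deriv (?u j) f z) = 0"
  proof (rule const_coeff_zero[OF _ _ U])
    fix \<eta> :: "'v \<Rightarrow> real" assume "linear \<eta>"
    then show "(\<Sum>j\<in>I \<times> UNIV. ?c j * (\<Prod>v\<leftarrow>?u j. complex_of_real (\<eta> v))) = 0"
      using sym unfolding split[of "\<lambda>us. \<Prod>v\<leftarrow>us. complex_of_real (\<eta> v)"] by simp
  qed (use assms(1) in simp)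
  then show ?thesis unfolding split[of "\<lambda>us. iter_deriv us f z"] by simp
qed

lemma iter_deriv_exp_linear:
  assumes "linear \<eta>"
  shows "iter_deriv vs (\<lambda>w. complex_of_real (exp (\<eta> w))) z
    = (\<Prod>v\<leftarrow>vs. complex_of_real (\<eta> v)) * of_real (exp (\<eta> z))"
proof (induction vs arbitrary: z)
  case (Cons v vs)
  let ?e = "\<lambda>w. complex_of_real (exp (\<eta> w))"
  have D: "(?e has_derivative (\<lambda>h. of_real (exp (\<eta> z) * \<eta> h))) (at z)"
    using linear_imp_has_derivative[OF assms]
    by (intro has_derivative_of_real) (auto intro!: derivative_eq_intros)
  have "iter_deriv vs ?e = (\<lambda>z. (\<Prod>v\<leftarrow>vs. complex_of_real (\<eta> v)) * ?e z)" using Cons.IH by blast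
  then show ?case
    by (simp add: dir_deriv_cmult[OF differentiableI[OF D]] has_derivative_dir_deriv[OF D])
qed simp

section \<open>Plane waves and determinant powers\<close>

context jordan begin

lemma plane_wave_exponent:
  "polynomial_function (\<lambda>Z. \<i> * complex_of_real (jtau mul a (fst (fst Z)) (fst (snd Z)) + jtau mul a (snd (fst Z)) (snd (snd Z))))"
proof -
  have "real_polynomial_function (\<lambda>Z. jtau mul a (fst (fst Z)) (fst (snd Z)) + jtau mul a (snd (fst Z)) (snd (snd Z)))"
    unfolding real_polynomial_function_eq
    by (intro polynomial_function_add polynomial_function_bilinear[OF tau_bilinear]
        polynomial_function_bounded_linear bounded_linear_intros)
  then show ?thesis by (simp add: complex_polynomial_function_iff real_polynomial_function.intros(2))
qed

lemma plane_wave_smooth: "smooth_at_all UNIV (\<lambda>(z, w). plane_wave mul a z w)"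
  using smooth_at_all_exp(1)[OF open_UNIV polynomial_function_smooth[OF plane_wave_exponent open_UNIV]]
  by (simp add: plane_wave_def case_prod_unfold)

lemma op_chain_plane_wave:
  assumes "\<And>j. poly_diff_op (T j)"
  shows "\<exists>q. polynomial_function q \<and> op_chain T k (plane_wave mul a z) = (\<lambda>w. q w * plane_wave mul a z w)"
proof -
  have "real_polynomial_function (\<lambda>w. jtau mul a (fst z) (fst w) + jtau mul a (snd z) (snd w))"
    unfolding real_polynomial_function_eq
    by (intro polynomial_function_add polynomial_function_bilinear[OF tau_bilinear] polynomial_function_const
        polynomial_function_bounded_linear bounded_linear_intros)
  then have "polynomial_function (\<lambda>w. \<i> * complex_of_real (jtau mul a (fst z) (fst w) + jtau mul a (snd z) (snd w)))"
    by (simp add: complex_polynomial_function_iff real_polynomial_function.intros(2))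
  from op_chain_poly_exp[OF assms polynomial_function_const[of 1] this, where k=k] show ?thesis
    by (simp add: plane_wave_def[abs_def])
qed

text \<open>The outermost \<open>F\<close> acts in \<open>z\<close>, so it passes through the chain
  already acting in \<open>w\<close> and meets the bare wave, where it becomes \<open>T k\<close>.
  The newest operator thus lands innermost, which reverses the order.\<close>

lemma F_comp_plane_wave:
  assumes "\<And>j. poly_diff_op (T j)"
    and "\<And>j. poly_diff_op (F (l + of_nat j) (m + of_nat j))"
    and F: "\<And>j z w. F (l + of_nat j) (m + of_nat j) (\<lambda>z. plane_wave mul a z w) z = T j (plane_wave mul a z) w"
  shows "F_comp F l m k (\<lambda>z. plane_wave mul a z w) z = op_chain T k (plane_wave mul a z) w"
proof (induction k arbitrary: z)
  case (Suc k)
  let ?F = "F (l + of_nat k) (m + of_nat k)"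
  have "F_comp F l m k (\<lambda>z. plane_wave mul a z w) = (\<lambda>z. op_chain T k (plane_wave mul a z) w)"
    using Suc.IH by blast
  then have "F_comp F l m (Suc k) (\<lambda>z. plane_wave mul a z w) z = ?F (\<lambda>z. op_chain T k (plane_wave mul a z) w) z"
    by simp
  also have "\<dots> = op_chain T k (\<lambda>w. ?F (\<lambda>z. plane_wave mul a z w) z) w"
    using op_chain_partial_commute[OF assms(2,1) plane_wave_smooth] by simp
  also have "(\<lambda>w. ?F (\<lambda>z. plane_wave mul a z w) z) = T k (plane_wave mul a z)"
    using F by blast
  finally show ?case by simp
qed simp

lemma polynomial_det: "real_polynomial_function (jdet mul e a)"
  unfolding jdet_def using rank_pos by (intro rpf_a) simp

text \<open>On this set principal powers of the determinants are smooth and agree with the signed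
  powers. It may be disconnected, which is harmless when extending polynomial identities.\<close>

definition cone2 :: "('a \<times> 'a) set" where
  "cone2 = {w. jdet mul e a (fst w) > 0 \<and> jdet mul e a (snd w) > 0}"

lemma polynomial_det_fst: "real_polynomial_function (\<lambda>w :: 'a \<times> 'a. jdet mul e a (fst w))"
  and polynomial_det_snd: "real_polynomial_function (\<lambda>w :: 'a \<times> 'a. jdet mul e a (snd w))"
  using real_polynomial_function_compose[OF polynomial_function_bounded_linear[OF bounded_linear_fst] polynomial_det]
    real_polynomial_function_compose[OF polynomial_function_bounded_linear[OF bounded_linear_snd] polynomial_det]
  by (simp_all add: o_def)

lemma open_cone2: "open cone2"
proof -
  have "continuous_on UNIV (\<lambda>w :: 'a \<times> 'a. jdet mul e a (fst w))" "continuous_on UNIV (\<lambda>w :: 'a \<times> 'a. jdet mul e a (snd w))"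
    using polynomial_det_fst polynomial_det_snd
    by (auto simp: real_polynomial_function_eq intro: continuous_on_polymonial_function)
  then show ?thesis unfolding cone2_def
    by (intro open_Collect_conj open_Collect_less continuous_on_const)
qed

lemma unit_in_cone2: "(e, e) \<in> cone2"
  by (simp add: cone2_def det_unit_pos)

lemma det_powers_smooth:
  "smooth_at_all cone2 (\<lambda>w. of_real (jdet mul e a (fst w)) powr s * of_real (jdet mul e a (snd w)) powr t)"
proof (intro smooth_at_all_mult smooth_at_all_powr open_cone2)
  show "smooth_at_all cone2 (\<lambda>w. of_real (jdet mul e a (fst w)))"
    "smooth_at_all cone2 (\<lambda>w. of_real (jdet mul e a (snd w)))"
    using polynomial_det_fst polynomial_det_snd
    by (auto intro!: polynomial_function_smooth open_cone2
        simp: complex_polynomial_function_iff real_polynomial_function.intros(2))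
qed (auto simp: cone2_def intro: differentiable_at_real_polynomial_function polynomial_det_fst polynomial_det_snd)

text \<open>The symbol depends on the difference of the two covectors only, so the operator can be rewritten
  with derivatives in the directions \<open>(v, -v)\<close> alone, and these annihilate the wave. Rewriting needs
  nondegeneracy of the trace form: otherwise the symbol is not determined everywhere.\<close>

lemma det_diff_op_plane_wave_commute:
  assumes P: "is_det_diff_op mul e a P" and U: "open U" "smooth_at_all U g" "w \<in> U"
  shows "P (\<lambda>w. plane_wave mul a (x, x) w * g w) w = plane_wave mul a (x, x) w * P g w"
proof -
  obtain I c where I: "finite I" and Pc: "\<And>f z. P f z = (\<Sum>vs\<in>I. c vs * iter_deriv vs f z)"
    using P unfolding is_det_diff_op_def const_diff_op_def by blast
  have Pexp: "P (\<lambda>(\<xi>, \<zeta>). of_real (exp (jtau mul a \<xi> x + jtau mul a \<zeta> y))) (\<xi>, \<zeta>) =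
          of_real (jdet mul e a (x - y)) * of_real (exp (jtau mul a \<xi> x + jtau mul a \<zeta> y))" for x y \<xi> \<zeta>
    using P unfolding is_det_diff_op_def by blast
  have tau: "linear (\<lambda>y. jtau mul a y x)" "linear (jtau mul a y)" for x y
    using tau_bilinear by (auto simp: bilinear_def)
  \<comment> \<open>Composing the linear form with covectors \<open>(x, y)\<close> with this map
    gives the covectors \<open>(x - y, 0)\<close>, at which the symbol has the same value
    \<open>det (x - y)\<close>.\<close>
  let ?\<pi> = "\<lambda>v :: 'a \<times> 'a. (fst v, - fst v)"
  have lin: "linear (\<lambda>w. jtau mul a (fst w) x + jtau mul a (snd w) y)" for x y
    by (rule linearI) (simp_all add: linear_add[OF tau(1)] linear_scale[OF tau(1)] algebra_simps)
  have symbol: "(\<Sum>vs\<in>I. c vs * (\<Prod>v\<leftarrow>vs. complex_of_real (jtau mul a (fst v) x + jtau mul a (snd v) y)))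
      = of_real (jdet mul e a (x - y))" for x y
    \<comment> \<open>At the origin the exponential is 1 and only the symbol is left.\<close>
    using Pexp[of x y 0 0]
    by (simp add: Pc case_prod_unfold iter_deriv_exp_linear[OF lin] linear_0[OF tau(1)])
  have \<pi>: "P f z = (\<Sum>vs\<in>I. c vs * iter_deriv (map ?\<pi> vs) f z)" if "smooth_at_all U f" "z \<in> U" for f z
    unfolding Pc
  proof (rule const_coeff_eq[OF I _ U(1) that])
    fix \<eta> :: "'a \<times> 'a \<Rightarrow> real" assume \<eta>: "linear \<eta>"
    have "linear (\<lambda>\<xi>. \<eta> (\<xi>, 0))" "linear (\<lambda>\<zeta>. \<eta> (0, \<zeta>))"
      using linear_compose[OF _ \<eta>, of "\<lambda>\<xi>. (\<xi>, 0)"] linear_compose[OF _ \<eta>, of "\<lambda>\<zeta>. (0, \<zeta>)"]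
      by (auto simp: o_def linear_iff)
    then obtain x y where xy: "\<And>\<xi>. \<eta> (\<xi>, 0) = jtau mul a \<xi> x" "\<And>\<zeta>. \<eta> (0, \<zeta>) = jtau mul a \<zeta> y"
      using tau_represents[of "\<lambda>\<xi>. \<eta> (\<xi>, 0)"] tau_represents[of "\<lambda>\<zeta>. \<eta> (0, \<zeta>)"] by blast
    have \<eta>_eq: "\<eta> v = jtau mul a (fst v) x + jtau mul a (snd v) y" for v
      using linear_add[OF \<eta>, of "(fst v, 0)" "(0, snd v)"] by (simp add: xy)
    have "\<eta> (?\<pi> v) = jtau mul a (fst v) (x - y) + jtau mul a (snd v) 0" for v
      by (simp add: \<eta>_eq linear_neg[OF tau(1)] linear_diff[OF tau(2)] linear_0[OF tau(2)])
    then have "(\<Sum>vs\<in>I. c vs * (\<Prod>v\<leftarrow>map ?\<pi> vs. complex_of_real (\<eta> v))) = of_real (jdet mul e a (x - y))"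
      using symbol[of "x - y" 0] by (simp add: o_def)
    moreover have "(\<Sum>vs\<in>I. c vs * (\<Prod>v\<leftarrow>vs. complex_of_real (\<eta> v))) = of_real (jdet mul e a (x - y))"
      using symbol[of x y] by (simp add: \<eta>_eq)
    ultimately show "(\<Sum>vs\<in>I. c vs * (\<Prod>v\<leftarrow>vs. complex_of_real (\<eta> v)))
        = (\<Sum>vs\<in>I. c vs * (\<Prod>v\<leftarrow>map ?\<pi> vs. complex_of_real (\<eta> v)))" by simp
  qed
  define E where "E = plane_wave mul a (x, x)"
  define \<psi> where "\<psi> w = \<i> * complex_of_real (jtau mul a x (fst w) + jtau mul a x (snd w))" for w
  have E: "E = (\<lambda>w. exp (\<psi> w))" by (simp add: E_def \<psi>_def plane_wave_def fun_eq_iff)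
  have lin\<psi>: "linear \<psi>"
    by (rule linearI) (simp_all add: \<psi>_def linear_add[OF tau(2)] linear_scale[OF tau(2)] scaleR_conv_of_real algebra_simps)
  then have pol: "polynomial_function \<psi>"
    by (simp add: linear_conv_bounded_linear polynomial_function_bounded_linear)
  have smE: "smooth_at_all V E" if "open V" for V
    unfolding E by (rule smooth_at_all_exp(1)[OF that polynomial_function_smooth[OF pol that]])
  have dE: "dir_deriv (?\<pi> v) E z = 0" for v z
  proof -
    have "dir_deriv (?\<pi> v) \<psi> z = \<psi> (?\<pi> v)"
      by (rule has_derivative_dir_deriv[OF linear_imp_has_derivative[OF lin\<psi>]])
    also have "\<dots> = 0" by (simp add: \<psi>_def linear_neg[OF tau(2)])
    finally show ?thesis
      unfolding E using smooth_at_all_exp(2)[OF open_UNIV polynomial_function_smooth[OF pol open_UNIV]] by simp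
  qed
  have comm: "iter_deriv (map ?\<pi> vs) (\<lambda>w. E w * g w) z = E z * iter_deriv (map ?\<pi> vs) g z" if "z \<in> U" for vs z
    using that
  proof (induction vs arbitrary: z)
    case (Cons v vs)
    have "iter_deriv (map ?\<pi> (v # vs)) (\<lambda>w. E w * g w) z = dir_deriv (?\<pi> v) (\<lambda>w. E w * iter_deriv (map ?\<pi> vs) g w) z"
      using dir_deriv_cong_open[OF U(1) Cons.prems Cons.IH] by simp
    also have "\<dots> = E z * dir_deriv (?\<pi> v) (iter_deriv (map ?\<pi> vs) g) z"
      using smooth_at_all_differentiable[OF smE[OF U(1)] Cons.prems]
        smooth_at_all_differentiable[OF smooth_at_all_iter_deriv[OF U(1,2)] Cons.prems]
      by (subst dir_deriv_mult) (simp_all add: dE)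
    finally show ?case by simp
  qed simp
  have "P (\<lambda>w. E w * g w) w = E w * P g w"
    using U by (simp add: \<pi> smooth_at_all_mult smE comm sum_distrib_left mult_ac)
  then show ?thesis by (simp add: E_def)
qed

lemma det_diff_op_funpow_plane_wave_commute:
  assumes P: "is_det_diff_op mul e a P" and U: "open U" "smooth_at_all U g" "w \<in> U"
  shows "(P ^^ k) (\<lambda>w. plane_wave mul a (x, x) w * g w) w = plane_wave mul a (x, x) w * (P ^^ k) g w"
  using U(2)
proof (induction k arbitrary: g)
  case (Suc k)
  have Pp: "poly_diff_op P" using P const_diff_op_imp_poly by (auto simp: is_det_diff_op_def)
  have "(P ^^ Suc k) (\<lambda>w. plane_wave mul a (x, x) w * g w) w
      = (P ^^ k) (P (\<lambda>w. plane_wave mul a (x, x) w * g w)) w" by (simp only: funpow_Suc_right o_apply)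
  also have "\<dots> = (P ^^ k) (\<lambda>w. plane_wave mul a (x, x) w * P g w) w"
    by (rule poly_diff_op_funpow_cong_open[OF Pp U(1,3)])
      (rule det_diff_op_plane_wave_commute[OF P U(1) Suc.prems])
  also have "\<dots> = plane_wave mul a (x, x) w * (P ^^ Suc k) g w"
    using Suc.IH[OF poly_diff_op_smooth[OF Pp U(1) Suc.prems]] by (simp only: funpow_Suc_right o_apply)
  finally show ?case .
qed simp

text \<open>Each \<open>P\<close> lowers both exponents by one and leaves a \<open>D\<close> acting
  on the remaining factor. The exponents descend from the top, so the \<open>D\<close> of largest
  index acts first, in the order of \<open>op_chain\<close>. The induction replaces \<open>f\<close>
  by its image, which is again smooth.\<close>

lemma det_diff_op_funpow_det_powers:
  assumes P: "is_det_diff_op mul e a P"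
    and D: "\<And>s t. is_D_op mul e a P s t (D s t)"
    and "smooth_at_all UNIV f" "w \<in> cone2"
  shows "(P ^^ k) (\<lambda>w. of_real (jdet mul e a (fst w)) powr (l + of_nat k) *
        of_real (jdet mul e a (snd w)) powr (m + of_nat k) * f w) w
    = of_real (jdet mul e a (fst w)) powr l * of_real (jdet mul e a (snd w)) powr m *
        op_chain (\<lambda>j. D (l + of_nat j + 1) (m + of_nat j + 1)) k f w"
  using assms(3)
proof (induction k arbitrary: f)
  case (Suc k)
  let ?T = "\<lambda>j. D (l + of_nat j + 1) (m + of_nat j + 1)"
  let ?h = "\<lambda>s t f w. complex_of_real (jdet mul e a (fst w)) powr s * of_real (jdet mul e a (snd w)) powr t * f w"
  have Pp: "poly_diff_op P" using P const_diff_op_imp_poly by (auto simp: is_det_diff_op_def)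
  have Tp: "poly_diff_op (?T k)" using D by (simp add: is_D_op_def)
  have step: "P (?h (l + of_nat (Suc k)) (m + of_nat (Suc k)) f) y = ?h (l + of_nat k) (m + of_nat k) (?T k f) y"
    if y: "y \<in> cone2" for y
  proof -
    let ?g = "\<lambda>(\<xi>, \<zeta>). signed_pow (l + of_nat k + 1) True (jdet mul e a \<xi>) *
      signed_pow (m + of_nat k + 1) True (jdet mul e a \<zeta>) * f (\<xi>, \<zeta>)"
    have inv: "fst y \<in> jinvertibles mul e" "snd y \<in> jinvertibles mul e"
      using y by (auto intro!: invertibleI simp: cone2_def)
    \<comment> \<open>Off \<open>cone2\<close> the two functions may differ, one taking powers of
      \<open>\<bar>d\<bar>\<close> and the other of \<open>d\<close>; only the germ at
      \<open>y\<close> matters.\<close>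
    have "P (?h (l + of_nat (Suc k)) (m + of_nat (Suc k)) f) y = P ?g y"
      by (rule poly_diff_op_cong_open[OF Pp open_cone2 y])
        (auto simp: cone2_def signed_pow_def case_prod_unfold add_ac)
    also have "\<dots> = signed_pow (l + of_nat k + 1 - 1) (\<not> True) (jdet mul e a (fst y)) *
        signed_pow (m + of_nat k + 1 - 1) (\<not> True) (jdet mul e a (snd y)) * ?T k f y"
      using D[of "l + of_nat k + 1" "m + of_nat k + 1", unfolded is_D_op_def, THEN conjunct2, rule_format,
          OF smooth_at_all_subset[OF Suc.prems subset_UNIV] inv, of True True]
      by (simp only: prod.collapse)
    \<comment> \<open>For positive determinants \<open>sgn\<close> is 1, so the flipped signs leave
      no trace.\<close>
    also have "\<dots> = ?h (l + of_nat k) (m + of_nat k) (?T k f) y"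
      using y by (simp add: signed_pow_def cone2_def)
    finally show ?thesis .
  qed
  have "(P ^^ Suc k) (?h (l + of_nat (Suc k)) (m + of_nat (Suc k)) f) w
      = (P ^^ k) (P (?h (l + of_nat (Suc k)) (m + of_nat (Suc k)) f)) w"
    by (simp only: funpow_Suc_right o_apply)
  also have "\<dots> = (P ^^ k) (?h (l + of_nat k) (m + of_nat k) (?T k f)) w"
    by (rule poly_diff_op_funpow_cong_open[OF Pp open_cone2 assms(4) step])
  also have "\<dots> = ?h l m (op_chain ?T k (?T k f)) w"
    by (rule Suc.IH[OF poly_diff_op_smooth[OF Tp open_UNIV Suc.prems]])
  finally show ?case by simp
qed simp

end

theorem theorem5p3:
  fixes mul :: "'a::euclidean_space \<Rightarrow> 'a \<Rightarrow> 'a" and e :: 'a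
    and a :: "nat \<Rightarrow> 'a \<Rightarrow> real"
    and P :: "('a \<times> 'a \<Rightarrow> complex) \<Rightarrow> 'a \<times> 'a \<Rightarrow> complex"
    and D F :: "complex \<Rightarrow> complex \<Rightarrow> ('a \<times> 'a \<Rightarrow> complex) \<Rightarrow> 'a \<times> 'a \<Rightarrow> complex"
    and l m :: complex and k :: nat
  assumes "simple_jordan_algebra mul e"
    and "generic_min_poly mul e a"
    and "is_det_diff_op mul e a P"
    and "\<And>s t. is_D_op mul e a P s t (D s t)"
    and "\<And>s t. is_source_op mul e a D s t (F s t)"
    and "k \<ge> 1"
  shows "(\<exists>!c. is_c_poly mul e a P (l - of_nat DIM('a) / of_nat (jrank mul e))
                 (m - of_nat DIM('a) / of_nat (jrank mul e)) k c) \<and>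
    (\<forall>x \<xi> \<zeta>. bidiff_symbol mul a (B_op F l m k) x \<xi> \<zeta> =
       c_poly mul e a P (l - of_nat DIM('a) / of_nat (jrank mul e))
         (m - of_nat DIM('a) / of_nat (jrank mul e)) k (\<xi>, \<zeta>))"
proof -
  interpret jordan mul e a using assms(1,2) by (rule jordan.intro)
  define l' m' where "l' = l - of_nat DIM('a) / of_nat (jrank mul e)"
    and "m' = m - of_nat DIM('a) / of_nat (jrank mul e)"
  define T where "T j = D (l' + of_nat j + 1) (m' + of_nat j + 1)" for j
  let ?h = "\<lambda>s t w. complex_of_real (jdet mul e a (fst w)) powr s * of_real (jdet mul e a (snd w)) powr t"
  have Tp: "poly_diff_op (T j)" for j using assms(4) by (simp add: T_def is_D_op_def)
  \<comment> \<open>The case \<open>f = 1\<close> of \<open>det\<close> below: with nothing but the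
    determinant powers under \<open>P ^^ k\<close>, the chain acts on 1.\<close>
  define c where "c = op_chain T k (\<lambda>w. 1)"
  have c: "polynomial_function c"
    using op_chain_poly_exp[where p="\<lambda>_. 1" and \<psi>="\<lambda>_. 0", OF Tp] by (auto simp: c_def)
  have det: "(P ^^ k) (\<lambda>w. ?h (l' + of_nat k) (m' + of_nat k) w * f w) w = ?h l' m' w * op_chain T k f w"
    if "smooth_at_all UNIV f" "w \<in> cone2" for f w
    using det_diff_op_funpow_det_powers[OF assms(3,4) that] by (simp add: T_def[abs_def])
  have det1: "(P ^^ k) (?h (l' + of_nat k) (m' + of_nat k)) w = c w * ?h l' m' w" if "w \<in> cone2" for w
    using det[OF smooth_at_all_const[OF open_UNIV, of 1] that] by (simp add: c_def mult_ac)
  have nz: "?h l' m' w \<noteq> 0" if "w \<in> cone2" for w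
    using that by (auto simp: cone2_def)
  \<comment> \<open>Uniqueness comes from cancelling the nonzero powers on \<open>cone2\<close>; two
    polynomials that agree there are equal.\<close>
  have is_c: "is_c_poly mul e a P l' m' k c' \<longleftrightarrow> c' = c" for c'
  proof
    assume c': "is_c_poly mul e a P l' m' k c'"
    have eq: "c' w * ?h l' m' w = c w * ?h l' m' w" if "w \<in> cone2" for w
    proof -
      have "(P ^^ k) (?h (l' + of_nat k) (m' + of_nat k)) (fst w, snd w)
          = c' (fst w, snd w) * of_real (jdet mul e a (fst w)) powr l' * of_real (jdet mul e a (snd w)) powr m'"
        using c'[unfolded is_c_poly_def, THEN conjunct2, rule_format, of "fst w" "snd w"] that
        unfolding cone2_def case_prod_unfold by blast
      then show ?thesis using det1[OF that] by (simp only: prod.collapse mult.assoc)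
    qed
    show "c' = c"
    proof (rule complex_polynomial_function_eq_on_open[OF _ c open_cone2 unit_in_cone2])
      show "polynomial_function c'" using c' by (simp add: is_c_poly_def)
      show "c' w = c w" if "w \<in> cone2" for w
        using eq[OF that] nz[OF that] by (simp only: mult_cancel_right simp_thms)
    qed
  next
    assume "c' = c"
    moreover have "(P ^^ k) (?h (l' + of_nat k) (m' + of_nat k)) (\<xi>, \<zeta>)
        = c (\<xi>, \<zeta>) * of_real (jdet mul e a \<xi>) powr l' * of_real (jdet mul e a \<zeta>) powr m'"
      if "jdet mul e a \<xi> > 0 \<and> jdet mul e a \<zeta> > 0" for \<xi> \<zeta>
      using det1[of "(\<xi>, \<zeta>)"] that by (simp only: cone2_def mem_Collect_eq fst_conv snd_conv mult.assoc)
    ultimately show "is_c_poly mul e a P l' m' k c'"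
      using c unfolding is_c_poly_def case_prod_unfold by blast
  qed
  have "bidiff_symbol mul a (B_op F l m k) x \<xi> \<zeta> = c (\<xi>, \<zeta>)" for x \<xi> \<zeta>
  proof -
    let ?E = "plane_wave mul a (x, x)"
    have E: "?E w \<noteq> 0" for w by (simp add: plane_wave_def)
    obtain q where q: "polynomial_function q" "op_chain T k ?E = (\<lambda>w. q w * ?E w)"
      using op_chain_plane_wave[of T k "(x, x)", OF Tp] by blast
    have "smooth_at_all UNIV ?E"
      using smooth_at_all_snd[OF plane_wave_smooth, of "(x, x)"] by simp
    note det_E = det[OF this]
    have "q w = c w" if w: "w \<in> cone2" for w
    proof -
      \<comment> \<open>\<open>P ^^ k\<close> of wave times powers is computed twice: with the wave
        as the function on which the chain acts, and with the wave pulled out in front. Comparing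
        the results gives \<open>q = c\<close> on \<open>cone2\<close>.\<close>
      have "?h l' m' w * (q w * ?E w) = (P ^^ k) (\<lambda>w. ?E w * ?h (l' + of_nat k) (m' + of_nat k) w) w"
        using det_E[OF w] unfolding q(2) by (simp only: mult.commute[of "?E _"])
      also have "\<dots> = ?E w * (P ^^ k) (?h (l' + of_nat k) (m' + of_nat k)) w"
        by (rule det_diff_op_funpow_plane_wave_commute[OF assms(3) open_cone2 det_powers_smooth w])
      also have "\<dots> = ?h l' m' w * (c w * ?E w)" using det1[OF w] by (simp add: mult_ac)
      finally show ?thesis using nz[OF w] E[of w] by simp
    qed
    then have qc: "q = c" by (rule complex_polynomial_function_eq_on_open[OF q(1) c open_cone2 unit_in_cone2])
    have "F_comp F l m k (\<lambda>z. plane_wave mul a z (\<xi>, \<zeta>)) (x, x) = op_chain T k ?E (\<xi>, \<zeta>)"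
    proof (rule F_comp_plane_wave[OF Tp])
      show "poly_diff_op (F (l + of_nat j) (m + of_nat j))" for j
        using assms(5) by (simp add: is_source_op_def)
      show "F (l + of_nat j) (m + of_nat j) (\<lambda>z. plane_wave mul a z w) z = T j (plane_wave mul a z) w" for j z w
        using assms(5)[of "l + of_nat j" "m + of_nat j"]
        by (simp add: is_source_op_def T_def l'_def m'_def algebra_simps del: split_paired_All)
    qed
    then show ?thesis
      using E by (simp add: bidiff_symbol_def B_op_def res_def q(2) qc)
  qed
  then show ?thesis
    unfolding c_poly_def l'_def[symmetric] m'_def[symmetric] is_c by simp
qed

end
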